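(* Let $\mathcal{T}\in\mathbb{R}^{n_1\times\dots\times n_d}$, let $\mathcal{I}=\{I_{\ell,k}\}$ ($0\le \ell\le L$, $1\le k\le K_\ell$) be an index tree on $D=\{1,\dots,d\}$, let $\mathcal{R}=(r_{\ell,k})$ be TTN ranks (positive integers) and $\mathcal{P}=(p_{\ell,k})$ oversampling parameters (nonnegative integers), and for every non-root node let $X_{\ell,k}\in\mathbb{R}^{n_{D\setminus I_{\ell,k}}\times r_{\ell,k}}$ and $Y_{\ell,k}\in\mathbb{R}^{n_{I_{\ell,k}}\times(r_{\ell,k}+p_{\ell,k})}$ be sketching matrices. Let $\widehat{\mathcal{T}}$ be the resulting TTNN approximant of $\mathcal{T}$. Then for any TTN ranks $\hat{\mathcal{R}}=(\hat r_{\ell,k})$ with $\hat{\mathcal{R}}<\mathcal{R}$ (that is, $\hat r_{\ell,k}<r_{\ell,k}$ for all non-root nodes), setting $$\rho_{\ell,k}=\sqrt{1+\|\widehat V_{\ell,k\perp}^{T}X_{\ell,k}(\widehat V_{\ell,k}^TX_{\ell,k})^\dagger\|_2^2},\qquad \tau_{\ell,k}=\sqrt{1+\|(Y_{\ell,k}^TQ_{\ell,k})^\dagger Y_{\ell,k}^TQ_{\ell,k\perp}\|_2^2},$$ $$\eta_{\ell,k}=1+\|(Y_{\ell,k}^TQ_{\ell,k})^\dagger Y_{\ell,k}^TQ_{\ell,k\perp}\|_2 ,$$ where $\widehat V_{\ell,k}$ is a matrix with orthonormal columns consisting of the first $\hat r_{\ell,k}$ right singular vectors of $\mathcal{T}^{\ell,k}$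 and $Q_{\ell,k}=\mathrm{orth}(\mathcal{T}^{\ell,k}X_{\ell,k})$, the following holds: $$\|\mathcal{T}-\widehat{\mathcal{T}}\|_F\le \|\mathcal{T}-\mathcal{T}_{\hat{\mathcal{R}}}\|_F\sum_{\ell=1}^{L}\sum_{k=1}^{K_\ell}\rho_{\ell,k}\,\tau_{\ell,k}\left(\prod_{j=1}^{K_L}\eta_{L,j}\right)\cdots\left(\prod_{j=1}^{K_{\ell+1}}\eta_{\ell+1,j}\right)\left(\prod_{j=k+1}^{K_\ell}\eta_{\ell,j}\right),$$ where $\mathcal{T}_{\hat{\mathcal{R}}}$ is any best TTN approximation of $\mathcal{T}$ of TTN rank $\hat{\mathcal{R}}$ (best in Frobenius norm, with respect to $\mathcal{I}$).
   Context: Matricization: for $I\subseteq D$ let $n_I=\prod_{i\in I}n_i$ (with $n_\emptyset=1$). For $\mathcal{S}\in\mathbb{R}^{n_1\times\dots\times n_d}$, $\mathcal{S}^I\in\mathbb{R}^{n_I\times n_{D\setminus I}}$ is the matrix whose rows are indexed by the multi-indices $(i_\mu)_{\mu\in I}$ and columns by $(i_\mu)_{\mu\in D\setminus I}$ (both enumerated in a fixed colexicographic order), with the corresponding entries of $\mathcal{S}$. The Frobenius norm of a tensor is the Euclidean norm of its entries. Index tree: a rooted tree $\mathcal{I}$ whose nodes are nonempty subsets $I_{\ell,k}\subseteq D$, where $\ell\in\{0,\dots,L\}$ is the level (depth) and $k\in\{1,\dots,K_\ell\}$ enumerates the nodes of level $\ell$; the root is $I_{0,1}=D$, and each node is either a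 leaf or contains the union of its children, which are pairwise disjoint (the union may be strictly smaller than the node). Leaves may lie at any level. Consequently distinct nodes of the same level are disjoint. Write $\mathcal{S}^{\ell,k}=\mathcal{S}^{I_{\ell,k}}$. TTN rank: given positive integers $\mathcal{R}=(r_{\ell,k})$ indexed by the non-root nodes, with the convention $r_{0,1}=1$, a tensor $\mathcal{S}$ has TTN rank $\mathcal{R}$ if there are matrices $U_{\ell,k}\in\mathbb{R}^{n_{I_{\ell,k}}\times r_{\ell,k}}$ for all nodes such that $U_{0,1}$ is the vectorization of $\mathcal{S}$, and for each non-leaf node $I$ with children $t_1,\dots,t_m$ and leftover indices $J=I\setminus(t_1\cup\dots\cup t_m)$ there is an array $B_I$ with $$U_I\big((i_\mu)_{\mu\in I},a\big)=\sum_{a_1,\dots,a_m}\Big(\prod_{s=1}^m U_{t_s}\big((i_\mu)_{\mu\in t_s},a_s\big)\Big)B_I\big(a_1,\dots,a_m,(i_\mu)_{\mu\in J},a\big)$$ (the $U$ at leaves are arbitrary). TTNN approximant: for each non-root node define $$P_{\ell,k}=\mathcal{T}^{\ell,k}X_{\ell,k}(Y_{\ell,k}^T\mathcal{T}^{\ell,k}X_{\ell,k})^\dagger Y_{\ell,k}^T\in\mathbb{R}^{n_{I_{\ell,k}}\times n_{I_{\ell,k}}}.$$ For $M\in\mathbb{R}^{n_I\times n_I}$ let $M^{[I]}$ be the linear operator on $\mathbb{R}^{n_1\times\dots\times n_d}$ with $(M^{[I]}\mathcal{S})^I=M\mathcal{S}^I$. Put $\mathcal{T}^{(0)}=\mathcal{T}$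 and $\mathcal{T}^{(\ell)}=P_{\ell,1}^{[I_{\ell,1}]}\cdots P_{\ell,K_\ell}^{[I_{\ell,K_\ell}]}\mathcal{T}^{(\ell-1)}$ for $\ell=1,\dots,L$ (operators of one level commute). The TTNN approximant is $\widehat{\mathcal{T}}=\mathcal{T}^{(L)}$. Linear algebra: $\dagger$ is the Moore–Penrose pseudoinverse; $\mathrm{orth}(M)$ is the orthonormal factor obtained by orthogonalizing the columns of $M$ (QR), so its columns form an orthonormal basis of the column space of $M$; for $M$ with orthonormal columns, $M_\perp$ is an orthogonal complement, i.e. $[M\ M_\perp]$ is square orthogonal; $\|\cdot\|_2$ is the spectral norm.
   Formalization: For every non-root node, V̂ᵀX is assumed to have full row rank and YᵀQ full column rank; without either the bound is false (d=2, T=e₁e₁ᵀ, r=2, r̂=1, with X=0 or Y=0 gives left side 1 and right side 0). *)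

theory Defs
  imports Complex_Main "HOL-Library.FuncSet" "Jordan_Normal_Form.DL_Rank"
begin

text \<open>
  A tensor of size \<open>n 1 \<times> \<dots> \<times> n d\<close> is a real function on multi-indices. Modes are numbered
  \<open>1, \<dots>, d\<close>; entries in mode \<open>\<mu>\<close> are numbered \<open>0, \<dots>, n \<mu> - 1\<close>, as are rows and columns of
  matrices. Values outside \<^term>\<open>PiE {1..d} (\<lambda>\<mu>. {..<n \<mu>})\<close> are never inspected.
\<close>

type_synonym multi_index = "nat \<Rightarrow> nat"
type_synonym tensor = "multi_index \<Rightarrow> real"

definition multi_indices :: "(nat \<Rightarrow> nat) \<Rightarrow> nat set \<Rightarrow> multi_index set" where
  "multi_indices n I = PiE I (\<lambda>\<mu>. {..<n \<mu>})"

definition size_of :: "(nat \<Rightarrow> nat) \<Rightarrow> nat set \<Rightarrow> nat" where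
  "size_of n I = (\<Prod>\<mu>\<in>I. n \<mu>)"

text \<open>
  Colexicographic enumeration of the multi-indices over \<open>I\<close> (the smallest mode varies fastest):
  \<open>colex n I i\<close> is the position of \<open>i\<close>, and \<open>colex_inv n I a\<close> the multi-index at position \<open>a\<close>.
\<close>

definition colex :: "(nat \<Rightarrow> nat) \<Rightarrow> nat set \<Rightarrow> multi_index \<Rightarrow> nat" where
  "colex n I i = (\<Sum>\<mu>\<in>I. i \<mu> * size_of n {\<nu>\<in>I. \<nu> < \<mu>})"

definition colex_inv :: "(nat \<Rightarrow> nat) \<Rightarrow> nat set \<Rightarrow> nat \<Rightarrow> multi_index" where
  "colex_inv n I a = (\<lambda>\<mu>\<in>I. (a div size_of n {\<nu>\<in>I. \<nu> < \<mu>}) mod n \<mu>)"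

definition join :: "nat set \<Rightarrow> multi_index \<Rightarrow> multi_index \<Rightarrow> multi_index" where
  "join I x y = (\<lambda>\<mu>. if \<mu> \<in> I then x \<mu> else y \<mu>)"

definition matricize :: "(nat \<Rightarrow> nat) \<Rightarrow> nat set \<Rightarrow> nat set \<Rightarrow> tensor \<Rightarrow> real mat" where
  "matricize n D I S =
     mat (size_of n I) (size_of n (D - I))
       (\<lambda>(a, b). S (join I (colex_inv n I a) (colex_inv n (D - I) b)))"

definition tensorize :: "(nat \<Rightarrow> nat) \<Rightarrow> nat set \<Rightarrow> nat set \<Rightarrow> real mat \<Rightarrow> tensor" where
  "tensorize n D I A = (\<lambda>i. A $$ (colex n I i, colex n (D - I) i))"

text \<open>The operator \<open>M\<^sup>[\<^sup>I\<^sup>]\<close>; its defining property is proved as \<open>matricize_mode_apply\<close> below.\<close>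

definition mode_apply ::
    "(nat \<Rightarrow> nat) \<Rightarrow> nat set \<Rightarrow> nat set \<Rightarrow> real mat \<Rightarrow> tensor \<Rightarrow> tensor" where
  "mode_apply n D I M S = tensorize n D I (M * matricize n D I S)"

definition frob_norm :: "(nat \<Rightarrow> nat) \<Rightarrow> nat set \<Rightarrow> tensor \<Rightarrow> real" where
  "frob_norm n D S = sqrt (\<Sum>i\<in>multi_indices n D. (S i)\<^sup>2)"

lemma colex_colex_inv_mod:
  assumes "finite I"
  shows "colex n I (colex_inv n I a) = a mod size_of n I"
  using assms
proof (induction I rule: finite_linorder_max_induct)
  case empty
  then show ?case by (simp add: colex_def size_of_def)
next
  case (insert b A)
  have b: "b \<notin> A" using insert by blast
  have below_b: "{\<nu>\<in>insert b A. \<nu> < b} = A" using insert by auto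
  have below: "{\<nu>\<in>insert b A. \<nu> < \<mu>} = {\<nu>\<in>A. \<nu> < \<mu>}" if "\<mu> \<in> A" for \<mu>
    using insert that by (auto dest: less_asym)
  have rest: "(\<Sum>\<mu>\<in>A. colex_inv n (insert b A) a \<mu> * size_of n {\<nu>\<in>insert b A. \<nu> < \<mu>})
      = colex n A (colex_inv n A a)"
    unfolding colex_def by (rule sum.cong) (use below in \<open>simp_all add: colex_inv_def\<close>)
  have "colex n (insert b A) (colex_inv n (insert b A) a)
      = (a div size_of n A mod n b) * size_of n A + colex n A (colex_inv n A a)"
    unfolding colex_def[of n "insert b A"] sum.insert[OF insert(1) b] rest
    using below_b by (simp add: colex_inv_def)
  also have "\<dots> = size_of n A * (a div size_of n A mod n b) + a mod size_of n A"
    using insert.IH by simp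
  also have "\<dots> = a mod (size_of n A * n b)"
    by (simp add: mod_mult2_eq)
  also have "size_of n A * n b = size_of n (insert b A)"
    using insert b by (simp add: size_of_def mult.commute)
  finally show ?case .
qed

lemma matricize_tensorize:
  assumes "finite D" "I \<subseteq> D" "A \<in> carrier_mat (size_of n I) (size_of n (D - I))"
  shows "matricize n D I (tensorize n D I A) = A"
proof (rule eq_matI)
  fix a b assume "a < dim_row A" "b < dim_col A"
  then have a: "a < size_of n I" and b: "b < size_of n (D - I)" using assms by auto
  let ?i = "join I (colex_inv n I a) (colex_inv n (D - I) b)"
  have "colex n I ?i = colex n I (colex_inv n I a)"
    unfolding colex_def join_def by (rule sum.cong) auto
  moreover have "colex n (D - I) ?i = colex n (D - I) (colex_inv n (D - I) b)"
    unfolding colex_def join_def by (rule sum.cong) auto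
  ultimately have "colex n I ?i = a" "colex n (D - I) ?i = b"
    using a b assms finite_subset[of I D] by (simp_all add: colex_colex_inv_mod)
  then show "matricize n D I (tensorize n D I A) $$ (a, b) = A $$ (a, b)"
    using a b by (simp add: matricize_def tensorize_def)
qed (use assms in \<open>auto simp: matricize_def\<close>)

lemma matricize_mode_apply:
  assumes "finite D" "I \<subseteq> D" "M \<in> carrier_mat (size_of n I) (size_of n I)"
  shows "matricize n D I (mode_apply n D I M S) = M * matricize n D I S"
  unfolding mode_apply_def using assms
  by (intro matricize_tensorize) (auto simp: matricize_def)

definition orthonormal_cols :: "real mat \<Rightarrow> bool" where
  "orthonormal_cols A \<longleftrightarrow> A\<^sup>T * A = 1\<^sub>m (dim_col A)"

definition square_orthogonal :: "real mat \<Rightarrow> bool" where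
  "square_orthogonal A \<longleftrightarrow> dim_row A = dim_col A \<and> orthonormal_cols A"

text \<open>\<open>N\<close> is an admissible choice of \<open>M\<^sub>\<bottom>\<close>, i.e. \<open>[M N]\<close> is square orthogonal.\<close>

definition is_orth_compl :: "real mat \<Rightarrow> real mat \<Rightarrow> bool" where
  "is_orth_compl M N \<longleftrightarrow>
     dim_row N = dim_row M \<and>
     square_orthogonal (mat_of_cols (dim_row M) (cols M @ cols N))"

text \<open>\<open>Q\<close> is an admissible choice of \<open>orth(M)\<close>; the number of columns of \<open>Q\<close> is the rank of \<open>M\<close>.\<close>

definition is_orth :: "real mat \<Rightarrow> real mat \<Rightarrow> bool" where
  "is_orth M Q \<longleftrightarrow>
     dim_row Q = dim_row M \<and> orthonormal_cols Q \<and>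
     vec_space.col_space (dim_row M) Q = vec_space.col_space (dim_row M) M"

definition is_pseudoinverse :: "real mat \<Rightarrow> real mat \<Rightarrow> bool" where
  "is_pseudoinverse A B \<longleftrightarrow>
     B \<in> carrier_mat (dim_col A) (dim_row A) \<and>
     A * B * A = A \<and> B * A * B = B \<and> (A * B)\<^sup>T = A * B \<and> (B * A)\<^sup>T = B * A"

definition pinv :: "real mat \<Rightarrow> real mat" where
  "pinv A = (THE B. is_pseudoinverse A B)"

text \<open>The constraint \<open>\<le> 1\<close> (rather than \<open>= 1\<close>) makes this \<open>0\<close> for matrices without columns.\<close>

definition spectral_norm :: "real mat \<Rightarrow> real" where
  "spectral_norm A =
     (SUP x\<in>{x \<in> carrier_vec (dim_col A). x \<bullet> x \<le> 1}. sqrt ((A *\<^sub>v x) \<bullet> (A *\<^sub>v x)))"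

definition is_svd :: "real mat \<Rightarrow> real mat \<Rightarrow> real mat \<Rightarrow> real mat \<Rightarrow> bool" where
  "is_svd A U S V \<longleftrightarrow>
     U \<in> carrier_mat (dim_row A) (dim_row A) \<and> square_orthogonal U \<and>
     V \<in> carrier_mat (dim_col A) (dim_col A) \<and> square_orthogonal V \<and>
     S \<in> carrier_mat (dim_row A) (dim_col A) \<and> diagonal_mat S \<and>
     (\<forall>i < min (dim_row A) (dim_col A). 0 \<le> S $$ (i, i)) \<and>
     (\<forall>i j. i \<le> j \<and> j < min (dim_row A) (dim_col A) \<longrightarrow> S $$ (j, j) \<le> S $$ (i, i)) \<and>
     A = U * S * V\<^sup>T"

definition first_right_singular_vectors :: "real mat \<Rightarrow> nat \<Rightarrow> real mat \<Rightarrow> bool" where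
  "first_right_singular_vectors A r W \<longleftrightarrow>
     r \<le> dim_col A \<and>
     (\<exists>U S V. is_svd A U S V \<and> W = mat_of_cols (dim_col A) (take r (cols V)))"

definition full_row_rank :: "real mat \<Rightarrow> bool" where
  "full_row_rank A \<longleftrightarrow> vec_space.rank (dim_row A) A = dim_row A"

definition full_col_rank :: "real mat \<Rightarrow> bool" where
  "full_col_rank A \<longleftrightarrow> vec_space.rank (dim_row A) A = dim_col A"

text \<open>
  Node \<open>k\<close> of level \<open>l\<close> is the position \<open>(l, k)\<close> with \<open>l \<le> height t\<close> and \<open>1 \<le> k \<le> width t l\<close>; it
  carries the index set \<open>node t l k\<close>, and for \<open>l > 0\<close> its parent is \<open>(l - 1, parent t l k)\<close>. Nodes
  are positions rather than sets, since an only child may carry the same set as its parent.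
\<close>

record index_tree =
  height :: nat
  width :: "nat \<Rightarrow> nat"
  node :: "nat \<Rightarrow> nat \<Rightarrow> nat set"
  parent :: "nat \<Rightarrow> nat \<Rightarrow> nat"

definition nodes :: "index_tree \<Rightarrow> (nat \<times> nat) set" where
  "nodes t = {(l, k). l \<le> height t \<and> k \<in> {1..width t l}}"

definition nonroot_nodes :: "index_tree \<Rightarrow> (nat \<times> nat) set" where
  "nonroot_nodes t = {(l, k) \<in> nodes t. 0 < l}"

definition children :: "index_tree \<Rightarrow> nat \<Rightarrow> nat \<Rightarrow> nat set" where
  "children t l k = {j. (Suc l, j) \<in> nodes t \<and> parent t (Suc l) j = k}"

definition is_index_tree :: "nat set \<Rightarrow> index_tree \<Rightarrow> bool" where
  "is_index_tree D t \<longleftrightarrow>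
     width t 0 = 1 \<and> node t 0 1 = D \<and>
     (\<forall>l \<le> height t. 1 \<le> width t l) \<and>
     (\<forall>(l, k) \<in> nodes t. node t l k \<noteq> {} \<and> node t l k \<subseteq> D) \<and>
     (\<forall>(l, k) \<in> nonroot_nodes t. (l - 1, parent t l k) \<in> nodes t) \<and>
     (\<forall>(l, k) \<in> nodes t.
        (\<Union>j\<in>children t l k. node t (Suc l) j) \<subseteq> node t l k \<and>
        (\<forall>j\<in>children t l k. \<forall>j'\<in>children t l k.
           j \<noteq> j' \<longrightarrow> node t (Suc l) j \<inter> node t (Suc l) j' = {}))"

text \<open>Ranks are given for the non-root nodes only; the root always has rank \<open>1\<close>.\<close>

definition root_one :: "(nat \<Rightarrow> nat \<Rightarrow> nat) \<Rightarrow> nat \<Rightarrow> nat \<Rightarrow> nat" where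
  "root_one r l k = (if l = 0 then 1 else r l k)"

definition has_ttn_rank ::
    "(nat \<Rightarrow> nat) \<Rightarrow> nat set \<Rightarrow> index_tree \<Rightarrow> (nat \<Rightarrow> nat \<Rightarrow> nat) \<Rightarrow> tensor \<Rightarrow> bool" where
  "has_ttn_rank n D t r S \<longleftrightarrow>
     (\<exists>U :: nat \<Rightarrow> nat \<Rightarrow> real mat.
        (\<forall>(l, k) \<in> nodes t. U l k \<in> carrier_mat (size_of n (node t l k)) (root_one r l k)) \<and>
        U 0 1 = matricize n D D S \<and>
        (\<forall>(l, k) \<in> nodes t. children t l k \<noteq> {} \<longrightarrow>
           (\<exists>B :: (nat \<Rightarrow> nat) \<Rightarrow> multi_index \<Rightarrow> nat \<Rightarrow> real.
              \<forall>i \<in> multi_indices n (node t l k). \<forall>a < root_one r l k.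
                U l k $$ (colex n (node t l k) i, a) =
                  (\<Sum>c \<in> PiE (children t l k) (\<lambda>s. {..<root_one r (Suc l) s}).
                     (\<Prod>s\<in>children t l k. U (Suc l) s $$ (colex n (node t (Suc l) s) i, c s)) *
                     B c (restrict i (node t l k - (\<Union>s\<in>children t l k. node t (Suc l) s))) a))))"

definition is_best_ttn_approx ::
    "(nat \<Rightarrow> nat) \<Rightarrow> nat set \<Rightarrow> index_tree \<Rightarrow> (nat \<Rightarrow> nat \<Rightarrow> nat) \<Rightarrow> tensor \<Rightarrow> tensor \<Rightarrow> bool" where
  "is_best_ttn_approx n D t r T S \<longleftrightarrow>
     has_ttn_rank n D t r S \<and>
     (\<forall>S'. has_ttn_rank n D t r S' \<longrightarrow> frob_norm n D (T - S) \<le> frob_norm n D (T - S'))"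

text \<open>\<open>A\<close> stands for the matricization of the original tensor at the node.\<close>

definition sketch_proj :: "real mat \<Rightarrow> real mat \<Rightarrow> real mat \<Rightarrow> real mat" where
  "sketch_proj A X Y = A * X * pinv (Y\<^sup>T * A * X) * Y\<^sup>T"

fun ttnn_step ::
    "(nat \<Rightarrow> nat) \<Rightarrow> nat set \<Rightarrow> index_tree \<Rightarrow> (nat \<Rightarrow> nat \<Rightarrow> real mat) \<Rightarrow> (nat \<Rightarrow> nat \<Rightarrow> real mat) \<Rightarrow>
     tensor \<Rightarrow> nat \<Rightarrow> tensor" where
  "ttnn_step n D t X Y T 0 = T"
| "ttnn_step n D t X Y T (Suc l) =
     foldr (\<lambda>k. mode_apply n D (node t (Suc l) k)
                  (sketch_proj (matricize n D (node t (Suc l) k) T) (X (Suc l) k) (Y (Suc l) k)))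
       [1..<Suc (width t (Suc l))] (ttnn_step n D t X Y T l)"

definition ttnn_approx ::
    "(nat \<Rightarrow> nat) \<Rightarrow> nat set \<Rightarrow> index_tree \<Rightarrow> (nat \<Rightarrow> nat \<Rightarrow> real mat) \<Rightarrow> (nat \<Rightarrow> nat \<Rightarrow> real mat) \<Rightarrow>
     tensor \<Rightarrow> tensor" where
  "ttnn_approx n D t X Y T = ttnn_step n D t X Y T (height t)"

end

theory Submission
  imports Defs "HOL-Analysis.L2_Norm"
begin

text \<open>
  At each node the sketched projection is the oblique projection
  \<open>P = Q (Q\<^sup>T + Z Q\<^sub>\<bottom>\<^sup>T)\<close> with \<open>Z = (Y\<^sup>T Q)\<^sup>\<dagger> Y\<^sup>T Q\<^sub>\<bottom>\<close>. Hence \<open>P\<close> has norm at most \<open>\<eta>\<close>, and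
  applied to the original tensor it commits an error of at most \<open>\<tau> \<parallel>Q\<^sub>\<bottom>\<^sup>T A\<parallel> \<le> \<tau> \<rho> \<parallel>A V\<^sub>\<bottom>\<parallel>\<close>. The last
  norm is the error of the best approximation of \<open>A\<close> of rank \<open>rh\<close>, and the matricization of a
  tensor of TTN rank \<open>rh\<close> at the node has that rank. From \<open>T - P S = (T - P T) + P (T - S)\<close>, each
  projection adds its own error and multiplies the accumulated one by \<open>\<eta>\<close>.
\<close>

section \<open>Norms of matrices\<close>

text \<open>The same \<open>Z\<close> enters twice with different outcomes. In
  \<open>A - P A\<close> its contribution lies in the range of \<open>Q\<close>, orthogonal to
  \<open>Q\<^sub>\<bottom> Q\<^sub>\<bottom>\<^sup>T A\<close>, so Pythagoras gives the root in
  \<tau>; the root in \<rho> arises likewise from the orthogonal row spaces of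
  \<open>V\<^sup>T\<close> and \<open>V\<^sub>\<bottom>\<^sup>T\<close>. For a general
  \<open>S\<close> the terms \<open>Q\<^sup>T S\<close> and
  \<open>Z Q\<^sub>\<bottom>\<^sup>T S\<close> live in the same space, and the triangle inequality
  gives the sum \<eta>. The formula for \<open>P\<close> hinges on the reverse-order law for the
  pseudoinverse of a product, which fails in general. It holds for an injective left and a
  surjective right factor, and \<open>Y\<^sup>T A X = (Y\<^sup>T Q) (Q\<^sup>T A X)\<close> is of
  this kind: \<open>Q\<close> spans exactly the range of \<open>A X\<close>, so the right factor is
  surjective even when \<open>A X\<close> is rank deficient. Errors of different nodes can be
  chained because all matricizations of a tensor have the same Frobenius norm, and because every
  sketch is taken from the original tensor, so that each own error is measured against it.\<close>

lemma mult_mat_assoc: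
  fixes A B C :: "'a :: semiring_0 mat"
  assumes "dim_col A = dim_row B" "dim_col B = dim_row C"
  shows "A * B * C = A * (B * C)"
  using assms by (intro assoc_mult_mat[of A _ _ B _ C]) auto

text \<open>Premises on dimensions instead of carriers, here and in \<open>mult_mat_assoc\<close>,
  can be discharged by the simplifier, which then reassociates and transposes long products.\<close>

lemma transpose_mult_dim:
  fixes A B :: "'a :: comm_semiring_0 mat"
  assumes "dim_col A = dim_row B"
  shows "(A * B)\<^sup>T = B\<^sup>T * A\<^sup>T"
  using assms by (intro transpose_mult[of A _ _ B]) auto

text \<open>Adjointness for two matrices at once: \<open>A\<^sup>T * B = 1\<close> turns it into an
  isometry, \<open>A\<^sup>T * B = 0\<close> into orthogonality of ranges.\<close>

lemma scalar_prod_mult_mat_vec: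
  fixes A B :: "real mat"
  assumes "dim_row A = dim_row B" "dim_vec v = dim_col A" "dim_vec w = dim_col B"
  shows "(A *\<^sub>v v) \<bullet> (B *\<^sub>v w) = v \<bullet> ((A\<^sup>T * B) *\<^sub>v w)"
proof -
  have "(A *\<^sub>v v) \<bullet> (B *\<^sub>v w) = v \<bullet> (A\<^sup>T *\<^sub>v (B *\<^sub>v w))"
  proof -
    have "B *\<^sub>v w \<in> carrier_vec (dim_row A)" "v \<in> carrier_vec (dim_col A)"
      using assms by (auto intro: carrier_vecI)
    from transpose_vec_mult_scalar[OF _ this, of "A\<^sup>T"] show ?thesis by simp
  qed
  also have "A\<^sup>T *\<^sub>v (B *\<^sub>v w) = (A\<^sup>T * B) *\<^sub>v w"
    using assms by (intro assoc_mult_mat_vec[symmetric, of _ "dim_col A" "dim_row A" _ "dim_col B"])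
      (auto intro: carrier_vecI)
  finally show ?thesis .
qed

section \<open>Inner products and lengths of real vectors\<close>

lemma scalar_prod_self_sum: "v \<bullet> v = (\<Sum>i<dim_vec v. (v $ i)\<^sup>2)" for v :: "real vec"
  by (simp add: scalar_prod_def power2_eq_square atLeast0LessThan)

lemma scalar_prod_self_nonneg: "0 \<le> v \<bullet> v" for v :: "real vec"
  by (simp add: scalar_prod_self_sum sum_nonneg)

lemma scalar_prod_self_eq_0_iff: "v \<bullet> v = 0 \<longleftrightarrow> v = 0\<^sub>v (dim_vec v)" for v :: "real vec"
proof
  assume "v \<bullet> v = 0"
  then show "v = 0\<^sub>v (dim_vec v)"
    by (intro eq_vecI) (auto simp: scalar_prod_self_sum sum_nonneg_eq_0_iff)
next
  assume "v = 0\<^sub>v (dim_vec v)"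
  then show "v \<bullet> v = 0" by (metis scalar_prod_left_zero zero_carrier_vec)
qed

lemma scalar_prod_Cauchy_Schwarz:
  fixes v w :: "real vec"
  assumes "dim_vec v = dim_vec w"
  shows "(v \<bullet> w)\<^sup>2 \<le> (v \<bullet> v) * (w \<bullet> w)"
proof -
  have "\<bar>v \<bullet> w\<bar> \<le> (\<Sum>i<dim_vec w. \<bar>v $ i\<bar> * \<bar>w $ i\<bar>)"
    unfolding scalar_prod_def atLeast0LessThan
    by (rule order.trans[OF sum_abs]) (simp add: abs_mult)
  also have "\<dots> \<le> L2_set (\<lambda>i. v $ i) {..<dim_vec w} * L2_set (\<lambda>i. w $ i) {..<dim_vec w}"
    by (rule L2_set_mult_ineq)
  also have "\<dots> = sqrt ((v \<bullet> v) * (w \<bullet> w))"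
    using assms by (simp add: L2_set_def scalar_prod_self_sum real_sqrt_mult)
  finally show ?thesis
    using real_le_rsqrt real_sqrt_le_iff by (metis real_sqrt_abs)
qed

text \<open>The Frobenius norm, written with \<open>L2_set\<close> to inherit its triangle
  inequality.\<close>

definition mat_norm :: "real mat \<Rightarrow> real" where
  "mat_norm A = L2_set (\<lambda>ij. A $$ ij) ({..<dim_row A} \<times> {..<dim_col A})"

lemma mat_norm_nonneg: "0 \<le> mat_norm A"
  by (simp add: mat_norm_def)

text \<open>Reduces facts about the Frobenius norm to facts about single column vectors.\<close>

lemma mat_norm_power2_cols: "(mat_norm A)\<^sup>2 = (\<Sum>j<dim_col A. col A j \<bullet> col A j)"
proof -
  have "(mat_norm A)\<^sup>2 = (\<Sum>i<dim_row A. \<Sum>j<dim_col A. (A $$ (i, j))\<^sup>2)"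
    by (simp add: mat_norm_def L2_set_def sum_nonneg sum.cartesian_product)
  also have "\<dots> = (\<Sum>j<dim_col A. \<Sum>i<dim_row A. (A $$ (i, j))\<^sup>2)"
    by (rule sum.swap)
  also have "\<dots> = (\<Sum>j<dim_col A. col A j \<bullet> col A j)"
    by (simp add: scalar_prod_self_sum)
  finally show ?thesis .
qed

lemma mat_norm_transpose: "mat_norm (A\<^sup>T) = mat_norm A"
  unfolding mat_norm_def L2_set_def
  by (rule arg_cong[where f = sqrt],
      rule sum.reindex_bij_witness[where i = prod.swap and j = prod.swap]) auto

lemma mat_norm_triangle:
  assumes "dim_row A = dim_row B" "dim_col A = dim_col B"
  shows "mat_norm (A + B) \<le> mat_norm A + mat_norm B"
proof -
  have "mat_norm (A + B) = L2_set (\<lambda>ij. A $$ ij + B $$ ij) ({..<dim_row A} \<times> {..<dim_col A})"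
    unfolding mat_norm_def using assms by (intro L2_set_cong) auto
  then show ?thesis
    using L2_set_triangle_ineq[of "\<lambda>ij. A $$ ij" "\<lambda>ij. B $$ ij"] assms by (simp add: mat_norm_def)
qed

lemma col_mult_mat: "j < dim_col B \<Longrightarrow> col (A * B) j = A *\<^sub>v col B j"
  by (intro eq_vecI) auto

lemma mat_norm_mult_orthonormal_cols:
  assumes "orthonormal_cols M" "dim_row B = dim_col M"
  shows "mat_norm (M * B) = mat_norm B"
proof -
  have "(M *\<^sub>v col B j) \<bullet> (M *\<^sub>v col B j) = col B j \<bullet> col B j" for j
    using assms by (simp add: scalar_prod_mult_mat_vec orthonormal_cols_def carrier_vecI)
  then have "(mat_norm (M * B))\<^sup>2 = (mat_norm B)\<^sup>2"
    by (simp add: mat_norm_power2_cols col_mult_mat)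
  then show ?thesis by (simp add: mat_norm_nonneg)
qed

text \<open>Pythagoras in each column, as the ranges of \<open>M\<close> and \<open>N\<close> are
  orthogonal. It is stated for differences because both residuals that produce the roots in \<rho>
  and \<tau> are differences.\<close>

lemma mat_norm_power2_diff_orthogonal:
  assumes "dim_row M = dim_row N" "dim_row B = dim_col M" "dim_row C = dim_col N"
    "dim_col B = dim_col C" "M\<^sup>T * N = 0\<^sub>m (dim_col M) (dim_col N)"
  shows "(mat_norm (M * B - N * C))\<^sup>2 = (mat_norm (M * B))\<^sup>2 + (mat_norm (N * C))\<^sup>2"
proof -
  have "col (M * B - N * C) j \<bullet> col (M * B - N * C) j =
      col (M * B) j \<bullet> col (M * B) j + col (N * C) j \<bullet> col (N * C) j" if j: "j < dim_col B" for j
  proof -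
    let ?v = "col (M * B) j" and ?w = "col (N * C) j"
    have vw: "?v \<in> carrier_vec (dim_row M)" "?w \<in> carrier_vec (dim_row M)"
      using assms by (auto intro: carrier_vecI)
    have diff: "col (M * B - N * C) j = ?v - ?w"
      using j assms by (intro eq_vecI) auto
    have "0\<^sub>m (dim_col M) (dim_col N) *\<^sub>v col C j = 0\<^sub>v (dim_col M)"
      using assms by (intro eq_vecI) (auto intro!: scalar_prod_left_zero carrier_vecI)
    then have "?v \<bullet> ?w = col B j \<bullet> 0\<^sub>v (dim_col M)"
      using j assms by (simp add: col_mult_mat scalar_prod_mult_mat_vec)
    also have "\<dots> = 0"
      using assms by (intro scalar_prod_right_zero carrier_vecI) simp
    finally have "?v \<bullet> ?w = 0" .
    then show ?thesis
      unfolding diff using vw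
      by (simp add: minus_scalar_prod_distrib[OF vw] scalar_prod_minus_distrib
          comm_scalar_prod[of ?w "dim_row M" ?v])
  qed
  then have "(\<Sum>j<dim_col B. col (M * B - N * C) j \<bullet> col (M * B - N * C) j) =
      (\<Sum>j<dim_col B. col (M * B) j \<bullet> col (M * B) j) + (\<Sum>j<dim_col B. col (N * C) j \<bullet> col (N * C) j)"
    by (simp add: sum.distrib)
  then show ?thesis
    using assms(4) by (simp add: mat_norm_power2_cols)
qed

text \<open>The supremum dominates its members only once the set is known to be bounded;
  Cauchy-Schwarz on each row of \<open>A\<close> bounds it by the Frobenius norm.\<close>

lemma spectral_norm_upper:
  assumes "dim_vec v = dim_col A" "v \<bullet> v \<le> 1"
  shows "sqrt ((A *\<^sub>v v) \<bullet> (A *\<^sub>v v)) \<le> spectral_norm A"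
proof -
  have mem: "v \<in> {x \<in> carrier_vec (dim_col A). x \<bullet> x \<le> 1}"
    using assms by (auto intro: carrier_vecI)
  have bdd: "bdd_above ((\<lambda>x. sqrt ((A *\<^sub>v x) \<bullet> (A *\<^sub>v x))) ` {x \<in> carrier_vec (dim_col A). x \<bullet> x \<le> 1})"
  proof (rule bdd_aboveI2)
    fix x :: "real vec" assume x: "x \<in> {x \<in> carrier_vec (dim_col A). x \<bullet> x \<le> 1}"
    have "(A *\<^sub>v x) \<bullet> (A *\<^sub>v x) = (\<Sum>i<dim_row A. (row A i \<bullet> x)\<^sup>2)"
      by (simp add: scalar_prod_self_sum)
    also have "\<dots> \<le> (\<Sum>i<dim_row A. row A i \<bullet> row A i)"
    proof (rule sum_mono)
      fix i
      have "(row A i \<bullet> x)\<^sup>2 \<le> (row A i \<bullet> row A i) * (x \<bullet> x)"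
        using x by (intro scalar_prod_Cauchy_Schwarz) auto
      also have "\<dots> \<le> (row A i \<bullet> row A i) * 1"
        using x by (intro mult_left_mono) (auto simp: scalar_prod_self_nonneg)
      finally show "(row A i \<bullet> x)\<^sup>2 \<le> row A i \<bullet> row A i" by simp
    qed
    finally show "sqrt ((A *\<^sub>v x) \<bullet> (A *\<^sub>v x)) \<le> sqrt (\<Sum>i<dim_row A. row A i \<bullet> row A i)"
      by simp
  qed
  show ?thesis
    unfolding spectral_norm_def by (rule cSUP_upper[OF mem bdd])
qed

text \<open>The zero vector is admissible in the supremum, also for a matrix without
  columns.\<close>

lemma spectral_norm_nonneg: "0 \<le> spectral_norm A"
proof -
  have "0 \<le> sqrt ((A *\<^sub>v 0\<^sub>v (dim_col A)) \<bullet> (A *\<^sub>v 0\<^sub>v (dim_col A)))"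
    by (simp add: scalar_prod_self_nonneg)
  also have "\<dots> \<le> spectral_norm A"
    by (rule spectral_norm_upper) (simp_all add: scalar_prod_left_zero[OF zero_carrier_vec])
  finally show ?thesis .
qed

lemma mult_mat_vec_spectral_norm:
  assumes "dim_vec v = dim_col A"
  shows "(A *\<^sub>v v) \<bullet> (A *\<^sub>v v) \<le> (spectral_norm A)\<^sup>2 * (v \<bullet> v)"
proof (cases "v \<bullet> v = 0")
  case True
  then have "v = 0\<^sub>v (dim_col A)" using assms scalar_prod_self_eq_0_iff by metis
  then have "A *\<^sub>v v = 0\<^sub>v (dim_row A)" by (intro eq_vecI) (auto simp: scalar_prod_right_zero)
  then show ?thesis using True by simp
next
  case False
  define c where "c = v \<bullet> v"
  have c: "0 < c" using False scalar_prod_self_nonneg[of v] by (simp add: c_def)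
  define w where "w = (1 / sqrt c) \<cdot>\<^sub>v v"
  have w: "dim_vec w = dim_col A" using assms by (simp add: w_def)
  have "w \<bullet> w = 1"
    using c by (simp add: w_def c_def[symmetric])
  then have "sqrt ((A *\<^sub>v w) \<bullet> (A *\<^sub>v w)) \<le> spectral_norm A"
    by (intro spectral_norm_upper w) simp
  then have "(A *\<^sub>v w) \<bullet> (A *\<^sub>v w) \<le> (spectral_norm A)\<^sup>2"
    by (simp add: sqrt_le_D)
  moreover have "A *\<^sub>v w = (1 / sqrt c) \<cdot>\<^sub>v (A *\<^sub>v v)"
    unfolding w_def using assms by (intro eq_vecI) auto
  then have "(A *\<^sub>v w) \<bullet> (A *\<^sub>v w) = (A *\<^sub>v v) \<bullet> (A *\<^sub>v v) / c"
    using c by simp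
  ultimately show ?thesis
    using c by (simp add: c_def field_simps)
qed

lemma mat_norm_mult_spectral_norm:
  assumes "dim_row B = dim_col A"
  shows "mat_norm (A * B) \<le> spectral_norm A * mat_norm B"
proof -
  have "(mat_norm (A * B))\<^sup>2 \<le> (\<Sum>j<dim_col B. (spectral_norm A)\<^sup>2 * (col B j \<bullet> col B j))"
    unfolding mat_norm_power2_cols
    using assms by (auto simp: col_mult_mat intro!: sum_mono mult_mat_vec_spectral_norm)
  also have "\<dots> = (spectral_norm A * mat_norm B)\<^sup>2"
    by (simp add: mat_norm_power2_cols power_mult_distrib sum_distrib_left)
  finally show ?thesis
    by (rule power2_le_imp_le) (simp add: spectral_norm_nonneg mat_norm_nonneg)
qed

section \<open>Pseudoinverses\<close>

text \<open>\<open>A B\<close> and \<open>A C\<close> are both the orthogonal projection onto the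
  range of \<open>A\<close>, and \<open>B A\<close> and \<open>C A\<close> both that onto its row
  space. The equalities follow by absorbing one projection into the other and transposing.\<close>

lemma is_pseudoinverse_unique:
  assumes "is_pseudoinverse A B" "is_pseudoinverse A C"
  shows "B = C"
proof -
  have dims: "dim_row B = dim_col A" "dim_col B = dim_row A" "dim_row C = dim_col A" "dim_col C = dim_row A"
    using assms by (auto simp: is_pseudoinverse_def)
  have B: "A * B * A = A" "B * A * B = B" "(A * B)\<^sup>T = A * B" "(B * A)\<^sup>T = B * A"
    and C: "A * C * A = A" "C * A * C = C" "(A * C)\<^sup>T = A * C" "(C * A)\<^sup>T = C * A"
    using assms by (auto simp: is_pseudoinverse_def)
  have "A * B = (A * C) * (A * B)"
    using B C dims by (metis mult_mat_assoc index_mult_mat(2,3))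
  then have "(A * B)\<^sup>T = (A * B)\<^sup>T * (A * C)\<^sup>T"
    using dims by (metis transpose_mult_dim index_mult_mat(2,3))
  also have "\<dots> = A * C"
    using B C dims by (metis mult_mat_assoc index_mult_mat(2,3))
  finally have AB: "A * B = A * C" using B by simp
  have "B * A = (B * A) * (C * A)"
    using B C dims by (metis mult_mat_assoc index_mult_mat(2,3))
  then have "(B * A)\<^sup>T = (C * A)\<^sup>T * (B * A)\<^sup>T"
    using dims by (metis transpose_mult_dim index_mult_mat(2,3))
  also have "\<dots> = C * A"
    using B C dims by (metis mult_mat_assoc index_mult_mat(2,3))
  finally have BA: "B * A = C * A" using B by simp
  \<comment> \<open>\<open>B = B A B = B A C = C A C = C\<close>.\<close>
  show ?thesis
    using AB BA B C dims by (metis mult_mat_assoc)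
qed

text \<open>Every pseudoinverse below is evaluated this way: a matrix with the Penrose properties is
  exhibited, and uniqueness identifies it with the definite description.\<close>

lemma pinv_eqI: "is_pseudoinverse A B \<Longrightarrow> pinv A = B"
  unfolding pinv_def by (rule the_equality) (auto intro: is_pseudoinverse_unique)

text \<open>Transposition exchanges the two symmetry conditions; it carries the left-inverse case
  over to right inverses.\<close>

lemma is_pseudoinverse_transpose:
  assumes "is_pseudoinverse A B"
  shows "is_pseudoinverse (A\<^sup>T) (B\<^sup>T)"
proof -
  have dims: "dim_row B = dim_col A" "dim_col B = dim_row A"
    using assms by (auto simp: is_pseudoinverse_def)
  have B: "A * B * A = A" "B * A * B = B" "(A * B)\<^sup>T = A * B" "(B * A)\<^sup>T = B * A"
    using assms by (auto simp: is_pseudoinverse_def)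
  have 1: "A\<^sup>T * B\<^sup>T = B * A" "B\<^sup>T * A\<^sup>T = A * B"
    using B dims by (simp_all add: transpose_mult_dim)
  have "B * A * A\<^sup>T = (A * (B * A)\<^sup>T)\<^sup>T"
    using dims by (simp add: transpose_mult_dim)
  also have "A * (B * A)\<^sup>T = A"
    using B dims by (metis mult_mat_assoc)
  finally have 2: "B * A * A\<^sup>T = A\<^sup>T" .
  have "A * B * B\<^sup>T = (B * (A * B)\<^sup>T)\<^sup>T"
    using dims by (simp add: transpose_mult_dim)
  also have "B * (A * B)\<^sup>T = B"
    using B dims by (metis mult_mat_assoc)
  finally have 3: "A * B * B\<^sup>T = B\<^sup>T" .
  show ?thesis
    unfolding is_pseudoinverse_def 1 2 3 B using dims by auto
qed

text \<open>The pseudoinverse of \<open>M\<close> is \<open>(M\<^sup>T M)\<^sup>-\<^sup>1 M\<^sup>T\<close>.\<close>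
lemma injective_left_pseudoinverse:
  fixes M :: "real mat"
  assumes inj: "\<And>v. v \<in> carrier_vec (dim_col M) \<Longrightarrow> M *\<^sub>v v = 0\<^sub>v (dim_row M) \<Longrightarrow> v = 0\<^sub>v (dim_col M)"
  obtains L where "is_pseudoinverse M L" "L * M = 1\<^sub>m (dim_col M)"
proof -
  let ?n = "dim_col M"
  let ?G = "M\<^sup>T * M"
  have G: "?G \<in> carrier_mat ?n ?n" by auto
  have "det ?G \<noteq> 0"
  proof
    assume "det ?G = 0"
    then obtain v where v: "v \<in> carrier_vec ?n" "v \<noteq> 0\<^sub>v ?n" "?G *\<^sub>v v = 0\<^sub>v ?n"
      using det_0_iff_vec_prod_zero_field[OF G] by blast
    have "(M *\<^sub>v v) \<bullet> (M *\<^sub>v v) = v \<bullet> (?G *\<^sub>v v)"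
      using v(1) by (intro scalar_prod_mult_mat_vec) auto
    also have "\<dots> = 0" unfolding v(3) using v(1) by (rule scalar_prod_right_zero)
    finally have "M *\<^sub>v v = 0\<^sub>v (dim_row M)"
      by (simp add: scalar_prod_self_eq_0_iff)
    with inj v show False by blast
  qed
  from det_non_zero_imp_unit[OF G this, unfolded Units_def, of "()"]
  obtain H where H: "H \<in> carrier_mat ?n ?n" and HG: "H * ?G = 1\<^sub>m ?n" and GH: "?G * H = 1\<^sub>m ?n"
    by (auto simp: ring_mat_def)
  have dH: "dim_row H = ?n" "dim_col H = ?n" using H by auto
  have "?G\<^sup>T = ?G" by (simp add: transpose_mult_dim)
  then have GHT: "?G * H\<^sup>T = 1\<^sub>m ?n"
    using HG dH by (metis transpose_mult_dim transpose_one index_mult_mat(2) index_transpose_mat(2))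
  \<comment> \<open>\<open>H G H\<^sup>T\<close> equals \<open>H\<^sup>T\<close> because
    \<open>H G = 1\<close>, and \<open>H\<close> because \<open>G H\<^sup>T = 1\<close>. Symmetry of
    \<open>H\<close> makes \<open>M L = M H M\<^sup>T\<close> symmetric.\<close>
  have "H * (?G * H\<^sup>T) = H\<^sup>T"
    using mult_mat_assoc[of H ?G "H\<^sup>T"] HG dH by (simp del: GHT)
  then have sym: "H\<^sup>T = H"
    using GHT dH by (metis carrier_matI right_mult_one_mat)
  define L where "L = H * M\<^sup>T"
  have dL: "dim_row L = ?n" "dim_col L = dim_row M" using dH by (auto simp: L_def)
  have LM: "L * M = 1\<^sub>m ?n"
    using mult_mat_assoc[of H "M\<^sup>T" M] HG dH by (simp add: L_def)
  have proj_sym: "(M * L)\<^sup>T = M * L"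
    using dH sym by (simp add: L_def transpose_mult_dim mult_mat_assoc)
  have "is_pseudoinverse M L"
    unfolding is_pseudoinverse_def
    using dL LM proj_sym mult_mat_assoc[of M L M] by auto
  then show thesis using LM by (rule that)
qed

lemma right_pseudoinverse:
  fixes R :: "real mat"
  assumes inj: "\<And>x. x \<in> carrier_vec (dim_row R) \<Longrightarrow> R\<^sup>T *\<^sub>v x = 0\<^sub>v (dim_col R) \<Longrightarrow> x = 0\<^sub>v (dim_row R)"
  obtains K where "is_pseudoinverse R K" "R * K = 1\<^sub>m (dim_row R)"
proof -
  obtain L where L: "is_pseudoinverse (R\<^sup>T) L" "L * R\<^sup>T = 1\<^sub>m (dim_col (R\<^sup>T))"
    using injective_left_pseudoinverse[of "R\<^sup>T"] inj by auto
  have dL: "dim_row L = dim_row R" "dim_col L = dim_col R"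
    using L(1) by (auto simp: is_pseudoinverse_def)
  have "R * L\<^sup>T = (L * R\<^sup>T)\<^sup>T" using dL by (simp add: transpose_mult_dim)
  also have "\<dots> = 1\<^sub>m (dim_row R)" using L(2) by simp
  finally show thesis
    using that is_pseudoinverse_transpose[OF L(1)] by simp
qed

text \<open>A maximal independent set of columns has as many elements as the dimension, hence is a
  basis, so \<open>W\<close> is surjective. Then \<open>W\<^sup>T\<close> is injective: for
  \<open>x = W y\<close> in its kernel,
  \<open>x \<bullet> x = (W\<^sup>T x) \<bullet> y = 0\<close>.\<close>

lemma full_row_rank_pseudoinverse:
  assumes "full_row_rank W"
  shows "is_pseudoinverse W (pinv W)" "W * pinv W = 1\<^sub>m (dim_row W)"
proof -
  let ?n = "dim_row W"
  interpret vec_space "TYPE(real)" ?n .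
  have W: "W \<in> carrier_mat ?n (dim_col W)" by auto
  have colsW: "set (cols W) \<subseteq> carrier_vec ?n" using cols_dim by blast
  obtain S where S: "maximal S (\<lambda>T. T \<subseteq> set (cols W) \<and> lin_indpt T)"
    using maximal_exists_superset[of "set (cols W)" "\<lambda>T. T \<subseteq> set (cols W) \<and> lin_indpt T" "{}"]
    by (auto simp: finite_lin_indpt2)
  then have S': "S \<subseteq> set (cols W)" "lin_indpt S" by (auto simp: maximal_def)
  have "card S = ?n"
    using rank_card_indpt[OF W S] assms by (simp add: full_row_rank_def)
  moreover have "S \<subseteq> carrier_vec ?n" using S'(1) colsW by (rule order.trans)
  ultimately have "basis S"
    using S' finite_subset[OF S'(1)] by (intro dim_li_is_basis) (auto simp: dim_is_n)
  then have "span S = carrier_vec ?n" by (simp add: basis_def)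
  then have "carrier_vec ?n \<subseteq> col_space W"
    unfolding col_space_def using span_is_monotone[OF S'(1)] by simp
  then have surj: "\<exists>y \<in> carrier_vec (dim_col W). W *\<^sub>v y = x" if "x \<in> carrier_vec ?n" for x
    using that by (auto simp: col_space_eq[OF W])
  obtain K where K: "is_pseudoinverse W K" "W * K = 1\<^sub>m ?n"
  proof (rule right_pseudoinverse)
    fix x assume x: "x \<in> carrier_vec ?n" "W\<^sup>T *\<^sub>v x = 0\<^sub>v (dim_col W)"
    then obtain y where y: "y \<in> carrier_vec (dim_col W)" "W *\<^sub>v y = x" using surj by auto
    have "x \<bullet> x = (W\<^sup>T *\<^sub>v x) \<bullet> y"
      using x y transpose_vec_mult_scalar[OF W, of y x] by simp
    also have "\<dots> = 0" using x y by simp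
    finally show "x = 0\<^sub>v ?n" using x by (simp add: scalar_prod_self_eq_0_iff)
  qed
  then show "is_pseudoinverse W (pinv W)" "W * pinv W = 1\<^sub>m ?n"
    using pinv_eqI[OF K(1)] by auto
qed

lemma full_col_rank_pseudoinverse:
  assumes "full_col_rank M"
  shows "is_pseudoinverse M (pinv M)" "pinv M * M = 1\<^sub>m (dim_col M)"
proof -
  let ?n = "dim_row M"
  interpret vec_space "TYPE(real)" ?n .
  have M: "M \<in> carrier_mat ?n (dim_col M)" by auto
  have rank: "rank M = dim_col M" using assms by (simp add: full_col_rank_def)
  obtain S where S: "maximal S (\<lambda>T. T \<subseteq> set (cols M) \<and> lin_indpt T)"
    using maximal_exists_superset[of "set (cols M)" "\<lambda>T. T \<subseteq> set (cols M) \<and> lin_indpt T" "{}"]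
    by (auto simp: finite_lin_indpt2)
  then have "card S \<le> card (set (cols M))" by (auto simp: maximal_def intro: card_mono)
  \<comment> \<open>Linear independence concerns the set of columns and would overlook a repeated
    one; counting excludes repetitions.\<close>
  then have "distinct (cols M)"
    using rank_card_indpt[OF M S] rank card_length[of "cols M"] by (auto intro: card_distinct)
  then have "v = 0\<^sub>v (dim_col M)" if "v \<in> carrier_vec (dim_col M)" "M *\<^sub>v v = 0\<^sub>v ?n" for v
    using lin_depI[OF M that(1) _ that(2)] full_rank_lin_indpt[OF M rank] by blast
  then obtain L where L: "is_pseudoinverse M L" "L * M = 1\<^sub>m (dim_col M)"
    by (rule injective_left_pseudoinverse)
  then show "is_pseudoinverse M (pinv M)" "pinv M * M = 1\<^sub>m (dim_col M)"
    using pinv_eqI[OF L(1)] by auto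
qed

text \<open>The inner products \<open>L M\<close> and \<open>R K\<close> are identities, so
  \<open>M R K L\<close> collapses to the projection \<open>M L\<close> and \<open>K L M R\<close>
  to \<open>K R\<close>, both symmetric.\<close>

lemma pinv_mult:
  assumes dims: "dim_col M = dim_row R"
    and M: "is_pseudoinverse M L" "L * M = 1\<^sub>m (dim_col M)"
    and R: "is_pseudoinverse R K" "R * K = 1\<^sub>m (dim_row R)"
  shows "pinv (M * R) = K * L"
proof (rule pinv_eqI)
  have d: "dim_row L = dim_row R" "dim_col L = dim_row M" "dim_row K = dim_col R" "dim_col K = dim_row R"
    using M R dims by (auto simp: is_pseudoinverse_def)
  have "M * R * (K * L) = M * (R * K * L)"
    using d dims by (simp add: mult_mat_assoc)
  also have "\<dots> = M * L" using R d dims by simp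
  finally have 1: "M * R * (K * L) = M * L" .
  have "K * L * (M * R) = K * (L * M * R)"
    using d dims by (simp add: mult_mat_assoc)
  also have "\<dots> = K * R" using M d dims by simp
  finally have 2: "K * L * (M * R) = K * R" .
  have 3: "M * L * (M * R) = M * R"
    using M d dims mult_mat_assoc[of "M * L" M R] by (simp add: is_pseudoinverse_def)
  have 4: "K * R * (K * L) = K * L"
    using R d dims mult_mat_assoc[of "K * R" K L] by (simp add: is_pseudoinverse_def)
  show "is_pseudoinverse (M * R) (K * L)"
    unfolding is_pseudoinverse_def 1 2 3 4
    using M R d dims by (auto simp: is_pseudoinverse_def)
qed

section \<open>Sketched projections\<close>

text \<open>With \<open>W = [M N]\<close>, the blocks of \<open>W\<^sup>T W = 1\<close> are the
  orthogonality relations. Since \<open>W\<close> is square, also \<open>W W\<^sup>T = 1\<close>,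
  which is the resolution of the identity.\<close>

lemma is_orth_complD:
  assumes "is_orth_compl M N"
  shows "dim_row N = dim_row M" "orthonormal_cols M" "orthonormal_cols N"
    "M\<^sup>T * N = 0\<^sub>m (dim_col M) (dim_col N)" "N\<^sup>T * M = 0\<^sub>m (dim_col N) (dim_col M)"
    "M * M\<^sup>T + N * N\<^sup>T = 1\<^sub>m (dim_row M)"
proof -
  let ?m = "dim_row M" and ?p = "dim_col M" and ?q = "dim_col N"
  show N: "dim_row N = ?m" using assms by (simp add: is_orth_compl_def)
  define W where "W = mat_of_cols ?m (cols M @ cols N)"
  have W: "dim_row W = ?m" "dim_col W = ?p + ?q" by (auto simp: W_def)
  have sq: "?m = ?p + ?q" and orth: "W\<^sup>T * W = 1\<^sub>m (?p + ?q)"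
    using assms W by (auto simp: is_orth_compl_def square_orthogonal_def orthonormal_cols_def W_def)
  have colM: "col W j = col M j" if "j < ?p" for j
    using that unfolding W_def by (subst col_mat_of_cols) (auto simp: nth_append)
  have colN: "col W (?p + j) = col N j" if "j < ?q" for j
    using that N unfolding W_def
    by (subst col_mat_of_cols) (auto simp: nth_append intro: carrier_vecI)
  have ip: "col W i \<bullet> col W j = (if i = j then 1 else 0)" if "i < ?p + ?q" "j < ?p + ?q" for i j
    using arg_cong[OF orth, of "\<lambda>A. A $$ (i, j)"] that W by simp
  show "orthonormal_cols M"
    unfolding orthonormal_cols_def
  proof (rule eq_matI)
    fix i j assume ij: "i < dim_row (1\<^sub>m ?p :: real mat)" "j < dim_col (1\<^sub>m ?p :: real mat)"
    then show "(M\<^sup>T * M) $$ (i, j) = 1\<^sub>m ?p $$ (i, j)"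
      using ip[of i j] by (simp add: colM)
  qed auto
  show "orthonormal_cols N"
    unfolding orthonormal_cols_def
  proof (rule eq_matI)
    fix i j assume ij: "i < dim_row (1\<^sub>m ?q :: real mat)" "j < dim_col (1\<^sub>m ?q :: real mat)"
    then show "(N\<^sup>T * N) $$ (i, j) = 1\<^sub>m ?q $$ (i, j)"
      using ip[of "?p + i" "?p + j"] by (simp add: colN)
  qed auto
  show MN: "M\<^sup>T * N = 0\<^sub>m ?p ?q"
  proof (rule eq_matI)
    fix i j assume ij: "i < dim_row (0\<^sub>m ?p ?q :: real mat)" "j < dim_col (0\<^sub>m ?p ?q :: real mat)"
    then show "(M\<^sup>T * N) $$ (i, j) = 0\<^sub>m ?p ?q $$ (i, j)"
      using ip[of i "?p + j"] by (simp add: colM colN)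
  qed auto
  have "N\<^sup>T * M = (M\<^sup>T * N)\<^sup>T" using N by (simp add: transpose_mult_dim)
  then show "N\<^sup>T * M = 0\<^sub>m ?q ?p" by (simp add: MN)
  have "W * W\<^sup>T = 1\<^sub>m ?m"
    using orth W sq by (intro mat_mult_left_right_inverse[of "W\<^sup>T"]) auto
  moreover have "M * M\<^sup>T + N * N\<^sup>T = W * W\<^sup>T"
  proof (rule eq_matI)
    fix i j assume "i < dim_row (W * W\<^sup>T)" "j < dim_col (W * W\<^sup>T)"
    then have ij: "i < ?m" "j < ?m" by (auto simp: W)
    have sum_split: "(\<Sum>k<p + q. f k) = (\<Sum>k<p. f k) + (\<Sum>k<q. f (p + k))"
      for p q and f :: "nat \<Rightarrow> real"
      by (induction q) (simp_all add: add.assoc)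
    have WM: "W $$ (i, k) = M $$ (i, k)" if "k < ?p" "i < ?m" for i k
      using arg_cong[OF colM[OF that(1)], of "\<lambda>v. v $ i"] that W by simp
    have WN: "W $$ (i, ?p + k) = N $$ (i, k)" if "k < ?q" "i < ?m" for i k
      using arg_cong[OF colN[OF that(1)], of "\<lambda>v. v $ i"] that W N by simp
    have "(W * W\<^sup>T) $$ (i, j) = (\<Sum>k<?p + ?q. W $$ (i, k) * W $$ (j, k))"
      using ij W by (simp add: scalar_prod_def atLeast0LessThan)
    also have "\<dots> = (\<Sum>k<?p. W $$ (i, k) * W $$ (j, k)) + (\<Sum>k<?q. W $$ (i, ?p + k) * W $$ (j, ?p + k))"
      by (rule sum_split)
    also have "\<dots> = (\<Sum>k<?p. M $$ (i, k) * M $$ (j, k)) + (\<Sum>k<?q. N $$ (i, k) * N $$ (j, k))"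
      using ij by (simp add: WM WN)
    also have "\<dots> = (M * M\<^sup>T + N * N\<^sup>T) $$ (i, j)"
      using ij N by (simp add: scalar_prod_def atLeast0LessThan)
    finally show "(M * M\<^sup>T + N * N\<^sup>T) $$ (i, j) = (W * W\<^sup>T) $$ (i, j)" ..
  qed (auto simp: W N)
  ultimately show "M * M\<^sup>T + N * N\<^sup>T = 1\<^sub>m ?m" by simp
qed

text \<open>The QR factorization of \<open>B\<close> with \<open>R = Q\<^sup>T B\<close>. The
  columns of \<open>B\<close> lie in the range of \<open>Q\<close>, so projecting changes nothing.
  Conversely every \<open>Q x\<close> has the form \<open>B y\<close>, so
  \<open>x \<bullet> x = B y \<bullet> Q x = y \<bullet> R\<^sup>T x\<close>; hence
  \<open>R\<^sup>T\<close> is injective and \<open>R\<close> has a right inverse.\<close>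

lemma is_orth_factorization:
  assumes "is_orth B Q"
  shows "Q * (Q\<^sup>T * B) = B"
    "\<exists>K. is_pseudoinverse (Q\<^sup>T * B) K \<and> Q\<^sup>T * B * K = 1\<^sub>m (dim_col Q)"
proof -
  let ?m = "dim_row B"
  have Q: "dim_row Q = ?m" "Q\<^sup>T * Q = 1\<^sub>m (dim_col Q)"
    and space: "vec_space.col_space ?m Q = vec_space.col_space ?m B"
    using assms by (auto simp: is_orth_def orthonormal_cols_def)
  interpret vec_space "TYPE(real)" ?m .
  have "Q \<in> carrier_mat ?m (dim_col Q)" "B \<in> carrier_mat ?m (dim_col B)" using Q by auto
  note csp = this[THEN col_space_eq]
  show "Q * (Q\<^sup>T * B) = B"
  proof (rule eq_matI)
    fix i j assume ij: "i < ?m" "j < dim_col B"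
    have "B *\<^sub>v unit_vec (dim_col B) j = col B j" using ij by (intro eq_vecI) auto
    then have "col B j \<in> col_space B" using ij unfolding csp by (auto intro!: bexI[of _ "unit_vec (dim_col B) j"])
    then obtain y where y: "y \<in> carrier_vec (dim_col Q)" "Q *\<^sub>v y = col B j"
      unfolding space[symmetric] csp by blast
    have "col (Q * (Q\<^sup>T * B)) j = Q *\<^sub>v (Q\<^sup>T *\<^sub>v (Q *\<^sub>v y))"
      using ij y by (simp add: col_mult_mat)
    also have "Q\<^sup>T *\<^sub>v (Q *\<^sub>v y) = (Q\<^sup>T * Q) *\<^sub>v y"
      using Q y by (intro assoc_mult_mat_vec[symmetric, of _ "dim_col Q" ?m _ "dim_col Q"]) auto
    also have "\<dots> = y" using Q y by simp
    finally have "col (Q * (Q\<^sup>T * B)) j = col B j" using y by simp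
    from arg_cong[OF this, of "\<lambda>v. v $ i"] show "(Q * (Q\<^sup>T * B)) $$ (i, j) = B $$ (i, j)"
      using ij Q by simp
  qed (use Q in auto)
  let ?R = "Q\<^sup>T * B" and ?q = "dim_col Q"
  obtain K where "is_pseudoinverse ?R K" "?R * K = 1\<^sub>m (dim_row ?R)"
  proof (rule right_pseudoinverse)
    fix x assume x: "x \<in> carrier_vec (dim_row ?R)" "?R\<^sup>T *\<^sub>v x = 0\<^sub>v (dim_col ?R)"
    then have xq: "x \<in> carrier_vec ?q" by simp
    then have "Q *\<^sub>v x \<in> col_space Q" using Q unfolding csp by (auto intro: carrier_vecI)
    then obtain y where y: "y \<in> carrier_vec (dim_col B)" "B *\<^sub>v y = Q *\<^sub>v x"
      unfolding space csp by blast
    have "x \<bullet> x = (Q *\<^sub>v x) \<bullet> (Q *\<^sub>v x)"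
      using Q xq by (simp add: scalar_prod_mult_mat_vec)
    also have "\<dots> = (B *\<^sub>v y) \<bullet> (Q *\<^sub>v x)" using y by simp
    also have "\<dots> = y \<bullet> ((B\<^sup>T * Q) *\<^sub>v x)"
      using Q xq y by (intro scalar_prod_mult_mat_vec) auto
    also have "B\<^sup>T * Q = ?R\<^sup>T" using Q by (simp add: transpose_mult_dim)
    also have "y \<bullet> (?R\<^sup>T *\<^sub>v x) = 0" using x y by simp
    finally show "x = 0\<^sub>v (dim_row ?R)" using xq by (simp add: scalar_prod_self_eq_0_iff)
  qed
  then show "\<exists>K. is_pseudoinverse ?R K \<and> ?R * K = 1\<^sub>m ?q" by auto
qed

text \<open>The sketched projection is the oblique projection onto the range of \<open>Q\<close>; it does not depend
  on \<open>X\<close> beyond \<open>Q\<close>, since the coordinates \<open>Q\<^sup>T A X\<close> are cancelled by the pseudoinverse.\<close>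
lemma sketch_proj_eq:
  assumes dims: "dim_row X = dim_col A" "dim_row Y = dim_row A"
    and Q: "is_orth (A * X) Q" and Qp: "is_orth_compl Q Qp"
    and rank: "full_col_rank (Y\<^sup>T * Q)"
  shows "sketch_proj A X Y = Q * (Q\<^sup>T + pinv (Y\<^sup>T * Q) * (Y\<^sup>T * Qp) * Qp\<^sup>T)"
proof -
  let ?L = "pinv (Y\<^sup>T * Q)" and ?R = "Q\<^sup>T * (A * X)"
  have dQ: "dim_row Q = dim_row A" using Q by (simp add: is_orth_def)
  note compl = is_orth_complD[OF Qp]
  note L = full_col_rank_pseudoinverse[OF rank]
  have dL: "dim_row ?L = dim_col Q" "dim_col ?L = dim_col Y"
    using L(1) by (auto simp: is_pseudoinverse_def)
  obtain K where K: "is_pseudoinverse ?R K" "?R * K = 1\<^sub>m (dim_col Q)"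
    using is_orth_factorization(2)[OF Q] by auto
  have dK: "dim_row K = dim_col X" "dim_col K = dim_col Q"
    using K(1) by (auto simp: is_pseudoinverse_def)
  have AX: "A * X = Q * ?R" using is_orth_factorization(1)[OF Q] by simp
  have "Y\<^sup>T * A * X = Y\<^sup>T * (Q * ?R)"
    using dims dQ AX by (simp add: mult_mat_assoc)
  also have "\<dots> = Y\<^sup>T * Q * ?R"
    using dims dQ mult_mat_assoc[of "Y\<^sup>T" Q ?R] by simp
  finally have "pinv (Y\<^sup>T * A * X) = K * ?L"
    using pinv_mult[OF _ L K(1)] K(2) by simp
  then have "sketch_proj A X Y = Q * ?R * (K * ?L) * Y\<^sup>T"
    using AX by (simp add: sketch_proj_def)
  also have "\<dots> = Q * (?R * K * (?L * Y\<^sup>T))"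
    using dims dQ dK dL by (simp add: mult_mat_assoc)
  also have "?R * K * (?L * Y\<^sup>T) = ?L * Y\<^sup>T"
    using K(2) dL by simp
  \<comment> \<open>Inserting the resolution of the identity splits \<open>L Y\<^sup>T\<close>: the
    part along \<open>Q\<close> becomes \<open>Q\<^sup>T\<close>, as \<open>L\<close> is a left
    inverse of \<open>Y\<^sup>T Q\<close>, and the other part is
    \<open>Z Q\<^sub>\<bottom>\<^sup>T\<close>.\<close>
  also have "?L * Y\<^sup>T = ?L * (Y\<^sup>T * (Q * Q\<^sup>T + Qp * Qp\<^sup>T))"
    using compl(6) dQ dims dL by simp
  also have "Y\<^sup>T * (Q * Q\<^sup>T + Qp * Qp\<^sup>T) = Y\<^sup>T * (Q * Q\<^sup>T) + Y\<^sup>T * (Qp * Qp\<^sup>T)"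
    using dQ dims compl(1) by (intro mult_add_distrib_mat[of _ "dim_col Y" "dim_row A" _ "dim_row A"]) auto
  also have "?L * \<dots> = ?L * (Y\<^sup>T * (Q * Q\<^sup>T)) + ?L * (Y\<^sup>T * (Qp * Qp\<^sup>T))"
    using dQ dims dL compl(1)
    by (intro mult_add_distrib_mat[of _ "dim_col Q" "dim_col Y" _ "dim_row A"]) auto
  also have "?L * (Y\<^sup>T * (Q * Q\<^sup>T)) = ?L * (Y\<^sup>T * Q) * Q\<^sup>T"
    using dQ dims dL by (simp add: mult_mat_assoc)
  also have "\<dots> = Q\<^sup>T" using L(2) by simp
  also have "?L * (Y\<^sup>T * (Qp * Qp\<^sup>T)) = ?L * (Y\<^sup>T * Qp) * Qp\<^sup>T"
    using dQ dims dL compl(1) by (simp add: mult_mat_assoc)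
  finally show ?thesis .
qed

text \<open>The three claims share the decomposition of \<open>S\<close> along \<open>Q\<close> and
  \<open>Qp\<close>; the contraction bounds drop one of the two squares.\<close>

lemma
  assumes Q: "is_orth_compl Q Qp"
  shows mat_norm_transpose_mult_le: "dim_row S = dim_row Q \<Longrightarrow> mat_norm (Q\<^sup>T * S) \<le> mat_norm S"
    and mat_norm_compl_transpose_mult_le: "dim_row S = dim_row Q \<Longrightarrow> mat_norm (Qp\<^sup>T * S) \<le> mat_norm S"
    and mat_norm_power2_split: "dim_row S = dim_row Q \<Longrightarrow>
      (mat_norm S)\<^sup>2 = (mat_norm (Q\<^sup>T * S))\<^sup>2 + (mat_norm (Qp\<^sup>T * S))\<^sup>2"
proof -
  note compl = is_orth_complD[OF Q]
  have eq: "S = Q * (Q\<^sup>T * S) + Qp * (Qp\<^sup>T * S)" if d: "dim_row S = dim_row Q"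
  proof -
    have "S = (Q * Q\<^sup>T + Qp * Qp\<^sup>T) * S" using d compl(6) by simp
    also have "\<dots> = Q * Q\<^sup>T * S + Qp * Qp\<^sup>T * S"
      using d compl(1) by (intro add_mult_distrib_mat[of _ "dim_row Q" "dim_row Q" _ _ "dim_col S"]) auto
    finally show ?thesis using d compl(1) by (simp add: mult_mat_assoc)
  qed
  show split: "(mat_norm S)\<^sup>2 = (mat_norm (Q\<^sup>T * S))\<^sup>2 + (mat_norm (Qp\<^sup>T * S))\<^sup>2"
    if d: "dim_row S = dim_row Q"
  proof -
    \<comment> \<open>The double sign fits the sum to Pythagoras, which is available for
      differences.\<close>
    have "S = Q * (Q\<^sup>T * S) - Qp * (- (Qp\<^sup>T * S))"
      using d compl(1) by (subst eq[OF d]) (intro eq_matI, auto)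
    then have "(mat_norm S)\<^sup>2 = (mat_norm (Q * (Q\<^sup>T * S)))\<^sup>2 + (mat_norm (Qp * (- (Qp\<^sup>T * S))))\<^sup>2"
      using mat_norm_power2_diff_orthogonal[of Q Qp "Q\<^sup>T * S" "- (Qp\<^sup>T * S)"] d compl by simp
    also have "mat_norm (Q * (Q\<^sup>T * S)) = mat_norm (Q\<^sup>T * S)"
      by (rule mat_norm_mult_orthonormal_cols) (simp_all add: compl)
    also have "mat_norm (Qp * (- (Qp\<^sup>T * S))) = mat_norm (- (Qp\<^sup>T * S))"
      by (rule mat_norm_mult_orthonormal_cols) (simp_all add: compl)
    also have "mat_norm (- (Qp\<^sup>T * S)) = mat_norm (Qp\<^sup>T * S)"
      unfolding mat_norm_def L2_set_def by (auto intro!: arg_cong[where f = sqrt] sum.cong)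
    finally show ?thesis .
  qed
  show "mat_norm (Q\<^sup>T * S) \<le> mat_norm S" if d: "dim_row S = dim_row Q"
    by (rule power2_le_imp_le) (simp_all add: split[OF d] mat_norm_nonneg)
  show "mat_norm (Qp\<^sup>T * S) \<le> mat_norm S" if d: "dim_row S = dim_row Q"
    by (rule power2_le_imp_le) (simp_all add: split[OF d] mat_norm_nonneg)
qed

lemma transpose_minus_dim:
  fixes A B :: "'a :: ab_group_add mat"
  assumes "dim_row A = dim_row B" "dim_col A = dim_col B"
  shows "(A - B)\<^sup>T = A\<^sup>T - B\<^sup>T"
  using assms by (intro eq_matI) auto

text \<open>The outer factor \<open>Q\<close> is isometric; what remains is
  \<open>Q\<^sup>T S + Z (Qp\<^sup>T S)\<close>, whose summands are bounded separately. The two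
  summands of \<eta> come from here.\<close>

lemma sketch_proj_mult_norm_le:
  assumes dims: "dim_row X = dim_col A" "dim_row Y = dim_row A"
    and Q: "is_orth (A * X) Q" and Qp: "is_orth_compl Q Qp"
    and rank: "full_col_rank (Y\<^sup>T * Q)" and S: "dim_row S = dim_row A"
  shows "mat_norm (sketch_proj A X Y * S)
    \<le> (1 + spectral_norm (pinv (Y\<^sup>T * Q) * (Y\<^sup>T * Qp))) * mat_norm S"
proof -
  define Z where "Z = pinv (Y\<^sup>T * Q) * (Y\<^sup>T * Qp)"
  have dQ: "dim_row Q = dim_row A" using Q by (simp add: is_orth_def)
  note compl = is_orth_complD[OF Qp]
  have dZ: "dim_row Z = dim_col Q" "dim_col Z = dim_col Qp"
    using full_col_rank_pseudoinverse(1)[OF rank] by (auto simp: is_pseudoinverse_def Z_def)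
  have "sketch_proj A X Y * S = Q * ((Q\<^sup>T + Z * Qp\<^sup>T) * S)"
    using sketch_proj_eq[OF dims Q Qp rank] dQ S dZ compl(1)
    by (simp add: Z_def[symmetric] mult_mat_assoc)
  then have "mat_norm (sketch_proj A X Y * S) = mat_norm ((Q\<^sup>T + Z * Qp\<^sup>T) * S)"
    using dZ by (simp add: mat_norm_mult_orthonormal_cols[OF compl(2)])
  also have "(Q\<^sup>T + Z * Qp\<^sup>T) * S = Q\<^sup>T * S + Z * Qp\<^sup>T * S"
    using dQ dZ S compl(1)
    by (intro add_mult_distrib_mat[of _ "dim_col Q" "dim_row A" _ _ "dim_col S"]) auto
  also have "Z * Qp\<^sup>T * S = Z * (Qp\<^sup>T * S)"
    using dQ dZ S compl(1) by (simp add: mult_mat_assoc)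
  also have "mat_norm (Q\<^sup>T * S + Z * (Qp\<^sup>T * S)) \<le> mat_norm (Q\<^sup>T * S) + mat_norm (Z * (Qp\<^sup>T * S))"
    using dZ by (intro mat_norm_triangle) auto
  also have "mat_norm (Z * (Qp\<^sup>T * S)) \<le> spectral_norm Z * mat_norm (Qp\<^sup>T * S)"
    using dZ by (intro mat_norm_mult_spectral_norm) auto
  also have "\<dots> \<le> spectral_norm Z * mat_norm S"
    using dQ S by (intro mult_left_mono mat_norm_compl_transpose_mult_le[OF Qp] spectral_norm_nonneg) simp
  also have "mat_norm (Q\<^sup>T * S) \<le> mat_norm S"
    using dQ S by (intro mat_norm_transpose_mult_le[OF Qp]) simp
  finally show ?thesis by (simp add: Z_def[symmetric] algebra_simps)
qed

text \<open>The projection reproduces the component of \<open>A\<close> along \<open>Q\<close>, so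
  the residual is \<open>Qp B - Q Z B\<close> with \<open>B = Qp\<^sup>T A\<close>. These pieces are
  orthogonal, whence the root in \<tau>.\<close>

lemma sketch_proj_residual_le:
  assumes dims: "dim_row X = dim_col A" "dim_row Y = dim_row A"
    and Q: "is_orth (A * X) Q" and Qp: "is_orth_compl Q Qp"
    and rank: "full_col_rank (Y\<^sup>T * Q)"
  shows "mat_norm (A - sketch_proj A X Y * A)
    \<le> sqrt (1 + (spectral_norm (pinv (Y\<^sup>T * Q) * (Y\<^sup>T * Qp)))\<^sup>2) * mat_norm (Qp\<^sup>T * A)"
proof -
  define Z where "Z = pinv (Y\<^sup>T * Q) * (Y\<^sup>T * Qp)"
  have dQ: "dim_row Q = dim_row A" using Q by (simp add: is_orth_def)
  note compl = is_orth_complD[OF Qp]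
  have dZ: "dim_row Z = dim_col Q" "dim_col Z = dim_col Qp"
    using full_col_rank_pseudoinverse(1)[OF rank] by (auto simp: is_pseudoinverse_def Z_def)
  let ?B = "Qp\<^sup>T * A"
  have "sketch_proj A X Y * A = Q * ((Q\<^sup>T + Z * Qp\<^sup>T) * A)"
    using sketch_proj_eq[OF dims Q Qp rank] dQ dZ compl(1)
    by (simp add: Z_def[symmetric] mult_mat_assoc)
  also have "(Q\<^sup>T + Z * Qp\<^sup>T) * A = Q\<^sup>T * A + Z * Qp\<^sup>T * A"
    using dQ dZ compl(1)
    by (intro add_mult_distrib_mat[of _ "dim_col Q" "dim_row A" _ _ "dim_col A"]) auto
  also have "Z * Qp\<^sup>T * A = Z * ?B"
    using dQ dZ compl(1) by (simp add: mult_mat_assoc)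
  also have "Q * (Q\<^sup>T * A + Z * ?B) = Q * (Q\<^sup>T * A) + Q * (Z * ?B)"
    using dQ dZ
    by (intro mult_add_distrib_mat[of _ "dim_row A" "dim_col Q" _ "dim_col A"]) auto
  finally have P: "sketch_proj A X Y * A = Q * (Q\<^sup>T * A) + Q * (Z * ?B)" .
  have "A = (Q * Q\<^sup>T + Qp * Qp\<^sup>T) * A" using dQ compl(6) by simp
  also have "\<dots> = Q * Q\<^sup>T * A + Qp * Qp\<^sup>T * A"
    using dQ compl(1) by (intro add_mult_distrib_mat[of _ "dim_row A" "dim_row A" _ _ "dim_col A"]) auto
  finally have A: "A = Q * (Q\<^sup>T * A) + Qp * ?B"
    using dQ compl(1) by (simp add: mult_mat_assoc)
  have "A - sketch_proj A X Y * A = (Q * (Q\<^sup>T * A) + Qp * ?B) - (Q * (Q\<^sup>T * A) + Q * (Z * ?B))"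
    using A P by simp
  \<comment> \<open>Entries of products are kept folded, so that the identity is a mere cancellation
    of real summands.\<close>
  also have "\<dots> = Qp * ?B - Q * (Z * ?B)"
    using dQ dZ compl(1) by (intro eq_matI) (simp_all del: index_mult_mat(1))
  finally have "(mat_norm (A - sketch_proj A X Y * A))\<^sup>2 = (mat_norm (Qp * ?B - Q * (Z * ?B)))\<^sup>2"
    by simp
  also have "\<dots> = (mat_norm (Qp * ?B))\<^sup>2 + (mat_norm (Q * (Z * ?B)))\<^sup>2"
    using dQ dZ compl by (intro mat_norm_power2_diff_orthogonal) auto
  also have "mat_norm (Qp * ?B) = mat_norm ?B"
    by (simp add: mat_norm_mult_orthonormal_cols[OF compl(3)])
  also have "mat_norm (Q * (Z * ?B)) = mat_norm (Z * ?B)"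
    using dZ by (simp add: mat_norm_mult_orthonormal_cols[OF compl(2)])
  also have "(mat_norm ?B)\<^sup>2 + (mat_norm (Z * ?B))\<^sup>2 \<le> (mat_norm ?B)\<^sup>2 + (spectral_norm Z * mat_norm ?B)\<^sup>2"
    using dZ by (intro add_left_mono power_mono mat_norm_mult_spectral_norm mat_norm_nonneg) simp
  also have "\<dots> = (1 + (spectral_norm Z)\<^sup>2) * (mat_norm ?B)\<^sup>2"
    by (simp add: power_mult_distrib algebra_simps)
  finally have "sqrt ((mat_norm (A - sketch_proj A X Y * A))\<^sup>2)
      \<le> sqrt ((1 + (spectral_norm Z)\<^sup>2) * (mat_norm ?B)\<^sup>2)"
    by (rule real_sqrt_le_mono)
  then show ?thesis
    by (simp add: real_sqrt_mult mat_norm_nonneg Z_def[symmetric])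
qed

text \<open>The transpose has no larger spectral norm. For \<open>u = A\<^sup>T v\<close> one has
  \<open>u \<bullet> u = v \<bullet> A u\<close>; Cauchy-Schwarz and the bound for
  \<open>A u\<close> leave a common factor \<open>u \<bullet> u\<close> to cancel.\<close>

lemma mult_transpose_vec_spectral_norm:
  assumes "dim_vec v = dim_row A"
  shows "(A\<^sup>T *\<^sub>v v) \<bullet> (A\<^sup>T *\<^sub>v v) \<le> (spectral_norm A)\<^sup>2 * (v \<bullet> v)"
proof (cases "(A\<^sup>T *\<^sub>v v) \<bullet> (A\<^sup>T *\<^sub>v v) = 0")
  case True
  then show ?thesis by (simp add: scalar_prod_self_nonneg)
next
  case False
  let ?u = "A\<^sup>T *\<^sub>v v"
  have pos: "0 < ?u \<bullet> ?u" using False scalar_prod_self_nonneg[of ?u] by linarith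
  have "v \<in> carrier_vec (dim_row A)" using assms by (rule carrier_vecI)
  then have "?u \<bullet> ?u = v \<bullet> (A *\<^sub>v ?u)"
    by (intro transpose_vec_mult_scalar) (auto intro: carrier_vecI)
  then have "(?u \<bullet> ?u)\<^sup>2 \<le> (v \<bullet> v) * ((A *\<^sub>v ?u) \<bullet> (A *\<^sub>v ?u))"
    using scalar_prod_Cauchy_Schwarz[of v "A *\<^sub>v ?u"] assms by simp
  also have "\<dots> \<le> (v \<bullet> v) * ((spectral_norm A)\<^sup>2 * (?u \<bullet> ?u))"
    by (intro mult_left_mono mult_mat_vec_spectral_norm scalar_prod_self_nonneg) simp
  finally have "(?u \<bullet> ?u) * (?u \<bullet> ?u) \<le> ((spectral_norm A)\<^sup>2 * (v \<bullet> v)) * (?u \<bullet> ?u)"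
    by (simp add: power2_eq_square mult_ac)
  then show ?thesis using pos by (rule mult_right_le_imp_le)
qed

text \<open>A right factor acts on rows, hence the detour through the transpose; needed for the
  product \<open>A Vp G\<close>.\<close>

lemma mat_norm_mult_spectral_norm_right:
  assumes "dim_col B = dim_row G"
  shows "mat_norm (B * G) \<le> spectral_norm G * mat_norm B"
proof -
  have "mat_norm (B * G) = mat_norm (G\<^sup>T * B\<^sup>T)"
    using assms mat_norm_transpose[of "B * G"] by (simp add: transpose_mult_dim)
  also have "(mat_norm (G\<^sup>T * B\<^sup>T))\<^sup>2 \<le> (\<Sum>j<dim_row B. (spectral_norm G)\<^sup>2 * (row B j \<bullet> row B j))"
    unfolding mat_norm_power2_cols
    using assms by (auto simp: col_mult_mat intro!: sum_mono mult_transpose_vec_spectral_norm)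
  also have "\<dots> = (spectral_norm G)\<^sup>2 * (mat_norm (B\<^sup>T))\<^sup>2"
    by (simp add: mat_norm_power2_cols sum_distrib_left)
  finally have "(mat_norm (B * G))\<^sup>2 \<le> (spectral_norm G * mat_norm B)\<^sup>2"
    by (simp add: power_mult_distrib mat_norm_transpose)
  then show ?thesis
    by (rule power2_le_imp_le) (simp add: spectral_norm_nonneg mat_norm_nonneg)
qed

text \<open>Since \<open>Q\<^sub>\<bottom>\<^sup>T A X = 0\<close>, the matrix \<open>A\<close> may be replaced by
  \<open>A - A X (V\<^sup>T X)\<^sup>\<dagger> V\<^sup>T = A V\<^sub>\<bottom> (V\<^sub>\<bottom>\<^sup>T - V\<^sub>\<bottom>\<^sup>T X (V\<^sup>T X)\<^sup>\<dagger> V\<^sup>T)\<close>.\<close>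
lemma range_finder_le:
  assumes dims: "dim_row X = dim_col A" "dim_row V = dim_col A"
    and Q: "is_orth (A * X) Q" and Qp: "is_orth_compl Q Qp" and Vp: "is_orth_compl V Vp"
    and rank: "full_row_rank (V\<^sup>T * X)"
  shows "mat_norm (Qp\<^sup>T * A)
    \<le> sqrt (1 + (spectral_norm (Vp\<^sup>T * X * pinv (V\<^sup>T * X)))\<^sup>2) * mat_norm (A * Vp)"
proof -
  define W where "W = pinv (V\<^sup>T * X)"
  define G where "G = Vp\<^sup>T * X * W"
  note cQ = is_orth_complD[OF Qp] and cV = is_orth_complD[OF Vp]
  have dQ: "dim_row Q = dim_row A" using Q by (simp add: is_orth_def)
  note pW = full_row_rank_pseudoinverse[OF rank, folded W_def]
  have dW: "dim_row W = dim_col X" "dim_col W = dim_col V"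
    using pW(1) by (auto simp: is_pseudoinverse_def)
  have VXW: "V\<^sup>T * X * W = 1\<^sub>m (dim_col V)" using pW(2) by simp
  have dG: "dim_row G = dim_col Vp" "dim_col G = dim_col V" using dW by (auto simp: G_def)
  \<comment> \<open>The comparison matrix: its range lies in that of \<open>A X\<close>, so
    \<open>Qp\<^sup>T\<close> annihilates it, while \<open>A - B\<close> will turn out to factor
    through \<open>A Vp\<close>.\<close>
  define B where "B = A * X * (W * V\<^sup>T)"
  have dB: "dim_row B = dim_row A" "dim_col B = dim_col A" using dims by (auto simp: B_def)
  have "Qp\<^sup>T * (A * X) = Qp\<^sup>T * (Q * (Q\<^sup>T * (A * X)))"
    using is_orth_factorization(1)[OF Q] by simp
  also have "\<dots> = Qp\<^sup>T * Q * (Q\<^sup>T * (A * X))"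
    using dQ cQ(1) by (intro mult_mat_assoc[symmetric]) auto
  also have "\<dots> = 0\<^sub>m (dim_col Qp) (dim_col X)"
    unfolding cQ(5) by (intro left_mult_zero_mat) (auto simp: dQ)
  finally have QAX: "Qp\<^sup>T * (A * X) = 0\<^sub>m (dim_col Qp) (dim_col X)" .
  have "Qp\<^sup>T * B = Qp\<^sup>T * (A * X) * (W * V\<^sup>T)"
    unfolding B_def using dims dQ dW cQ(1) by (intro mult_mat_assoc[symmetric]) auto
  also have "\<dots> = 0\<^sub>m (dim_col Qp) (dim_col A)"
    unfolding QAX using dW dims by (intro left_mult_zero_mat) auto
  finally have QB: "Qp\<^sup>T * B = 0\<^sub>m (dim_col Qp) (dim_col A)" .
  have "Qp\<^sup>T * (A - B) = Qp\<^sup>T * A - Qp\<^sup>T * B"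
    using dB dQ cQ(1) by (intro mult_minus_distrib_mat[of _ "dim_col Qp" "dim_row A" _ "dim_col A"]) auto
  also have "\<dots> = Qp\<^sup>T * A" unfolding QB by (intro eq_matI) auto
  finally have "mat_norm (Qp\<^sup>T * A) = mat_norm (Qp\<^sup>T * (A - B))" by simp
  also have "\<dots> \<le> mat_norm (A - B)"
    using dB dQ by (intro mat_norm_compl_transpose_mult_le[OF Qp]) simp
  finally have 1: "mat_norm (Qp\<^sup>T * A) \<le> mat_norm (A - B)" .
  have AV: "A * V * V\<^sup>T + A * Vp * Vp\<^sup>T = A"
  proof -
    have "A = A * (V * V\<^sup>T + Vp * Vp\<^sup>T)" using dims cV(6) by simp
    also have "\<dots> = A * (V * V\<^sup>T) + A * (Vp * Vp\<^sup>T)"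
      using dims cV(1) by (intro mult_add_distrib_mat[of _ "dim_row A" "dim_col A" _ "dim_col A"]) auto
    finally show ?thesis using dims cV(1) by (simp add: mult_mat_assoc)
  qed
  \<comment> \<open>Splitting \<open>A\<close> along \<open>V\<close> and \<open>Vp\<close> makes
    \<open>V\<^sup>T X W = 1\<close> applicable to the first summand; the second acquires the factor
    \<open>G\<close>.\<close>
  have "A * X = (A * V * V\<^sup>T + A * Vp * Vp\<^sup>T) * X" by (simp add: AV)
  also have "\<dots> = A * V * V\<^sup>T * X + A * Vp * Vp\<^sup>T * X"
    using dims cV(1) by (intro add_mult_distrib_mat[of _ "dim_row A" "dim_col A" _ _ "dim_col X"]) auto
  finally have "A * X * W = (A * V * V\<^sup>T * X + A * Vp * Vp\<^sup>T * X) * W" by simp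
  also have "\<dots> = A * V * V\<^sup>T * X * W + A * Vp * Vp\<^sup>T * X * W"
    using dims cV(1) dW by (intro add_mult_distrib_mat[of _ "dim_row A" "dim_col X" _ _ "dim_col V"]) auto
  also have "A * V * V\<^sup>T * X * W = A * V * (V\<^sup>T * X * W)"
    using dims cV(1) dW by (simp add: mult_mat_assoc)
  also have "\<dots> = A * V" using VXW by simp
  also have "A * Vp * Vp\<^sup>T * X * W = A * Vp * G"
    using dims cV(1) dW by (simp add: G_def mult_mat_assoc)
  finally have AXW: "A * X * W = A * V + A * Vp * G" .
  have "B = A * X * W * V\<^sup>T"
    using dims dW by (simp add: B_def mult_mat_assoc)
  also have "\<dots> = A * V * V\<^sup>T + A * Vp * G * V\<^sup>T"
    unfolding AXW using dims dG by (intro add_mult_distrib_mat[of _ "dim_row A" "dim_col V" _ _ "dim_col A"]) auto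
  finally have B: "B = A * V * V\<^sup>T + A * Vp * G * V\<^sup>T" .
  have "A - B = (A * V * V\<^sup>T + A * Vp * Vp\<^sup>T) - (A * V * V\<^sup>T + A * Vp * G * V\<^sup>T)"
    using AV B by simp
  also have "\<dots> = A * Vp * Vp\<^sup>T - A * Vp * G * V\<^sup>T"
    using dims cV(1) by (intro eq_matI) (simp_all del: index_mult_mat(1))
  \<comment> \<open>The orthogonality is between row spaces here, while Pythagoras is available for
    column spaces; hence the transpose.\<close>
  also have "\<dots> = (Vp * (A * Vp)\<^sup>T - V * (A * Vp * G)\<^sup>T)\<^sup>T"
  proof -
    have "A * Vp * Vp\<^sup>T = (Vp * (A * Vp)\<^sup>T)\<^sup>T" by (simp add: transpose_mult_dim)
    moreover have "A * Vp * G * V\<^sup>T = (V * (A * Vp * G)\<^sup>T)\<^sup>T" using dG by (simp add: transpose_mult_dim)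
    ultimately show ?thesis
      using dims cV(1) by (simp add: transpose_minus_dim)
  qed
  finally have "mat_norm (A - B) = mat_norm (Vp * (A * Vp)\<^sup>T - V * (A * Vp * G)\<^sup>T)"
    by (simp add: mat_norm_transpose)
  then have "(mat_norm (A - B))\<^sup>2 = (mat_norm (Vp * (A * Vp)\<^sup>T))\<^sup>2 + (mat_norm (V * (A * Vp * G)\<^sup>T))\<^sup>2"
    using mat_norm_power2_diff_orthogonal[of Vp V "(A * Vp)\<^sup>T" "(A * Vp * G)\<^sup>T"] cV dG by simp
  also have "mat_norm (Vp * (A * Vp)\<^sup>T) = mat_norm (A * Vp)"
    by (subst mat_norm_mult_orthonormal_cols[OF cV(3)]) (simp_all add: mat_norm_transpose)
  also have "mat_norm (V * (A * Vp * G)\<^sup>T) = mat_norm (A * Vp * G)"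
    using dG by (subst mat_norm_mult_orthonormal_cols[OF cV(2)]) (simp_all add: mat_norm_transpose)
  also have "(mat_norm (A * Vp))\<^sup>2 + (mat_norm (A * Vp * G))\<^sup>2
      \<le> (mat_norm (A * Vp))\<^sup>2 + (spectral_norm G * mat_norm (A * Vp))\<^sup>2"
    using dG by (intro add_left_mono power_mono mat_norm_mult_spectral_norm_right mat_norm_nonneg) simp
  also have "\<dots> = (1 + (spectral_norm G)\<^sup>2) * (mat_norm (A * Vp))\<^sup>2"
    by (simp add: power_mult_distrib algebra_simps)
  finally have "sqrt ((mat_norm (A - B))\<^sup>2) \<le> sqrt ((1 + (spectral_norm G)\<^sup>2) * (mat_norm (A * Vp))\<^sup>2)"
    by (rule real_sqrt_le_mono)
  then have "mat_norm (A - B) \<le> sqrt (1 + (spectral_norm G)\<^sup>2) * mat_norm (A * Vp)"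
    by (simp add: real_sqrt_mult mat_norm_nonneg)
  with 1 show ?thesis by (simp add: G_def W_def)
qed

section \<open>Best low-rank approximation\<close>

text \<open>Pythagoras for the projection \<open>W W\<^sup>T\<close> when no orthogonal complement
  of \<open>W\<close> is at hand, as for the matrices built by orthonormalization.\<close>

lemma vec_minus_projection:
  fixes W :: "real mat" and v :: "real vec"
  assumes W: "orthonormal_cols W" and v: "dim_vec v = dim_row W"
  defines "e \<equiv> v - W *\<^sub>v (W\<^sup>T *\<^sub>v v)"
  shows "v \<bullet> v = (W\<^sup>T *\<^sub>v v) \<bullet> (W\<^sup>T *\<^sub>v v) + e \<bullet> e" "W\<^sup>T *\<^sub>v e = 0\<^sub>v (dim_col W)"
proof -
  let ?b = "W\<^sup>T *\<^sub>v v" and ?m = "dim_row W"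
  have vc: "v \<in> carrier_vec ?m" and Wb: "W *\<^sub>v ?b \<in> carrier_vec ?m"
    and bc: "?b \<in> carrier_vec (dim_col W)" and Wc: "W \<in> carrier_mat ?m (dim_col W)"
    and WTc: "W\<^sup>T \<in> carrier_mat (dim_col W) ?m"
    using v by (auto intro: carrier_vecI)
  have 1: "(W *\<^sub>v ?b) \<bullet> (W *\<^sub>v ?b) = ?b \<bullet> ?b"
    using W bc by (simp add: scalar_prod_mult_mat_vec orthonormal_cols_def)
  have 2: "v \<bullet> (W *\<^sub>v ?b) = ?b \<bullet> ?b"
    using transpose_vec_mult_scalar[OF Wc bc vc] by simp
  have "e \<bullet> e = (v \<bullet> v - v \<bullet> (W *\<^sub>v ?b)) - ((W *\<^sub>v ?b) \<bullet> v - (W *\<^sub>v ?b) \<bullet> (W *\<^sub>v ?b))"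
    unfolding e_def minus_scalar_prod_distrib[OF vc Wb minus_carrier_vec[OF vc Wb]]
      scalar_prod_minus_distrib[OF vc vc Wb] scalar_prod_minus_distrib[OF Wb vc Wb] ..
  also have "(W *\<^sub>v ?b) \<bullet> v = v \<bullet> (W *\<^sub>v ?b)" using Wb vc by (rule comm_scalar_prod)
  finally show "v \<bullet> v = ?b \<bullet> ?b + e \<bullet> e" using 1 2 by simp
  have "W\<^sup>T *\<^sub>v e = ?b - W\<^sup>T *\<^sub>v (W *\<^sub>v ?b)"
    unfolding e_def using vc Wb by (intro mult_minus_distrib_mat_vec) auto
  also have "W\<^sup>T *\<^sub>v (W *\<^sub>v ?b) = (W\<^sup>T * W) *\<^sub>v ?b"
    by (rule assoc_mult_mat_vec[symmetric, OF WTc Wc bc])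
  also have "\<dots> = ?b" using W bc by (simp add: orthonormal_cols_def)
  finally show "W\<^sup>T *\<^sub>v e = 0\<^sub>v (dim_col W)" using bc by simp
qed

lemma Bessel_le:
  fixes v :: "real vec"
  assumes "orthonormal_cols W" "dim_vec v = dim_row W"
  shows "(W\<^sup>T *\<^sub>v v) \<bullet> (W\<^sup>T *\<^sub>v v) \<le> v \<bullet> v"
  using vec_minus_projection(1)[OF assms] by (simp add: scalar_prod_self_nonneg)

lemma mat_norm_minus_projection:
  assumes "orthonormal_cols W" "dim_row M = dim_row W"
  shows "(mat_norm M)\<^sup>2 = (mat_norm (W\<^sup>T * M))\<^sup>2 + (mat_norm (M - W * (W\<^sup>T * M)))\<^sup>2"
proof -
  have "col (M - W * (W\<^sup>T * M)) j = col M j - W *\<^sub>v (W\<^sup>T *\<^sub>v col M j)" if "j < dim_col M" for j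
  proof -
    have "col (M - W * (W\<^sup>T * M)) j = col M j - col (W * (W\<^sup>T * M)) j"
      using that assms by (intro eq_vecI) auto
    then show ?thesis using that by (simp add: col_mult_mat)
  qed
  then have "col M j \<bullet> col M j = col (W\<^sup>T * M) j \<bullet> col (W\<^sup>T * M) j +
      col (M - W * (W\<^sup>T * M)) j \<bullet> col (M - W * (W\<^sup>T * M)) j" if "j < dim_col M" for j
    using vec_minus_projection(1)[OF assms(1), of "col M j"] assms(2) that by (simp add: col_mult_mat)
  then show ?thesis
    by (simp add: mat_norm_power2_cols sum.distrib)
qed

lemma mat_norm_one: "(mat_norm (1\<^sub>m k))\<^sup>2 = real k"
  by (simp add: mat_norm_power2_cols)

text \<open>Gram-Schmidt, one vector at a time; a vector already fixed by \<open>W W\<^sup>T\<close>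
  adds no column, so the number of columns is only bounded. That the projection fixes each vector
  expresses membership in the range of \<open>W\<close> in the form used later.\<close>

lemma orthonormalize:
  assumes "set vs \<subseteq> carrier_vec m"
  shows "\<exists>W. dim_row W = m \<and> dim_col W \<le> length vs \<and> orthonormal_cols W \<and>
    (\<forall>v\<in>set vs. W *\<^sub>v (W\<^sup>T *\<^sub>v v) = (v :: real vec))"
  using assms
proof (induction vs)
  case Nil
  have "orthonormal_cols (0\<^sub>m m 0)"
    unfolding orthonormal_cols_def by (intro eq_matI) auto
  then show ?case by (intro exI[of _ "0\<^sub>m m 0"]) simp
next
  case (Cons u vs)
  then obtain W where W: "dim_row W = m" "dim_col W \<le> length vs" "orthonormal_cols W"
    "\<And>v. v \<in> set vs \<Longrightarrow> W *\<^sub>v (W\<^sup>T *\<^sub>v v) = v"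
    by auto
  have u: "u \<in> carrier_vec m" "dim_vec u = m" using Cons.prems by auto
  define e where "e = u - W *\<^sub>v (W\<^sup>T *\<^sub>v u)"
  have e: "dim_vec e = m" "W\<^sup>T *\<^sub>v e = 0\<^sub>v (dim_col W)"
    using vec_minus_projection(2)[OF W(3), of u] u W(1) by (auto simp: e_def)
  show ?case
  proof (cases "e = 0\<^sub>v m")
    case True
    have "W *\<^sub>v (W\<^sup>T *\<^sub>v u) = u"
    proof (rule eq_vecI)
      fix i assume "i < dim_vec u"
      then show "(W *\<^sub>v (W\<^sup>T *\<^sub>v u)) $ i = u $ i"
        using arg_cong[OF True, of "\<lambda>v. v $ i"] W(1) u by (simp add: e_def del: index_mult_mat_vec)
    qed (use W u in auto)
    with W show ?thesis by (intro exI[of _ W]) auto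
  next
    case False
    then have "e \<bullet> e \<noteq> 0" using e by (simp add: scalar_prod_self_eq_0_iff)
    then have pos: "0 < e \<bullet> e" using scalar_prod_self_nonneg[of e] by linarith
    define c where "c = 1 / sqrt (e \<bullet> e)"
    have cc: "c * c * (e \<bullet> e) = 1"
      using pos by (simp add: c_def)
    define f where "f = c \<cdot>\<^sub>v e"
    have f: "dim_vec f = m" "f \<bullet> f = 1" using e cc by (auto simp: f_def mult_ac)
    have Wf: "col W k \<bullet> f = 0" if "k < dim_col W" for k
    proof -
      have "col W k \<bullet> e = (W\<^sup>T *\<^sub>v e) $ k" using that by simp
      then show ?thesis using that e W(1) by (simp add: f_def del: index_mult_mat_vec)
    qed
    define W' where "W' = mat m (Suc (dim_col W)) (\<lambda>(i, j). if j < dim_col W then W $$ (i, j) else f $ i)"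
    have W': "dim_row W' = m" "dim_col W' = Suc (dim_col W)" by (auto simp: W'_def)
    have colW: "col W' k = col W k" if "k < dim_col W" for k
      using that W(1) by (intro eq_vecI) (auto simp: W'_def)
    have colf: "col W' (dim_col W) = f"
      using f by (intro eq_vecI) (auto simp: W'_def)
    have fW: "f \<bullet> col W k = 0" if "k < dim_col W" for k
    proof -
      have "f \<bullet> col W k = col W k \<bullet> f"
        using f W(1) by (intro comm_scalar_prod[of _ m]) (auto intro: carrier_vecI)
      then show ?thesis using Wf[OF that] by simp
    qed
    have WW: "col W i \<bullet> col W j = (if i = j then 1 else 0)" if "i < dim_col W" "j < dim_col W" for i j
      using arg_cong[OF W(3)[unfolded orthonormal_cols_def], of "\<lambda>A. A $$ (i, j)"] that by simp
    have orth: "orthonormal_cols W'"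
      unfolding orthonormal_cols_def
    proof (rule eq_matI)
      fix i j assume "i < dim_row (1\<^sub>m (dim_col W') :: real mat)" "j < dim_col (1\<^sub>m (dim_col W') :: real mat)"
      then have "i < Suc (dim_col W)" "j < Suc (dim_col W)" using W' by auto
      then show "(W'\<^sup>T * W') $$ (i, j) = 1\<^sub>m (dim_col W') $$ (i, j)"
        using W' f WW Wf fW by (auto simp: less_Suc_eq colW colf)
    qed auto
    have proj: "(W' *\<^sub>v (W'\<^sup>T *\<^sub>v v)) $ i = (W *\<^sub>v (W\<^sup>T *\<^sub>v v)) $ i + f $ i * (f \<bullet> v)"
      if "i < m" for v i
    proof -
      have "(W' *\<^sub>v (W'\<^sup>T *\<^sub>v v)) $ i = (\<Sum>k<Suc (dim_col W). W' $$ (i, k) * (col W' k \<bullet> v))"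
        using that W' by (simp add: scalar_prod_def[of "row W' i"] atLeast0LessThan del: sum.lessThan_Suc)
      also have "\<dots> = (\<Sum>k<dim_col W. W $$ (i, k) * (col W k \<bullet> v)) + f $ i * (f \<bullet> v)"
        using that by (simp add: colW colf) (simp add: W'_def)
      also have "(\<Sum>k<dim_col W. W $$ (i, k) * (col W k \<bullet> v)) = (W *\<^sub>v (W\<^sup>T *\<^sub>v v)) $ i"
        using that W(1) by (simp add: scalar_prod_def[of "row W i"] atLeast0LessThan)
      finally show ?thesis .
    qed
    have old: "W' *\<^sub>v (W'\<^sup>T *\<^sub>v v) = v" if v: "v \<in> set vs" for v
    proof -
      have dv: "v \<in> carrier_vec m" using v Cons.prems by auto
      have "f \<bullet> v = v \<bullet> f" using f dv by (intro comm_scalar_prod[of _ m]) (auto intro: carrier_vecI)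
      also have "v \<bullet> f = (W *\<^sub>v (W\<^sup>T *\<^sub>v v)) \<bullet> f" by (simp add: W(4)[OF v])
      also have "\<dots> = (W\<^sup>T *\<^sub>v v) \<bullet> (W\<^sup>T *\<^sub>v f)"
      proof -
        have "f \<in> carrier_vec (dim_row W)" "W\<^sup>T *\<^sub>v v \<in> carrier_vec (dim_col W)"
          using f W(1) by (auto intro: carrier_vecI)
        from transpose_vec_mult_scalar[of "W\<^sup>T", OF _ this] show ?thesis by simp
      qed
      also have "W\<^sup>T *\<^sub>v f = 0\<^sub>v (dim_col W)" using Wf by (intro eq_vecI) auto
      also have "(W\<^sup>T *\<^sub>v v) \<bullet> 0\<^sub>v (dim_col W) = 0"
        by (intro scalar_prod_right_zero carrier_vecI) simp
      finally have "f \<bullet> v = 0" .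
      then show ?thesis
        using dv W(4)[OF v] W' by (intro eq_vecI) (auto simp: proj simp del: index_mult_mat_vec)
    qed
    \<comment> \<open>\<open>e\<close> is orthogonal to the range of \<open>W\<close>, so
      \<open>u\<close> may be replaced by \<open>e\<close>. The new column thus contributes
      \<open>f (f \<bullet> u) = c\<^sup>2 (e \<bullet> e) e = e\<close>, exactly what the old
      projection of \<open>u\<close> lacks.\<close>
    have fu: "f \<bullet> u = c * (e \<bullet> e)"
    proof -
      have "e \<bullet> (W *\<^sub>v (W\<^sup>T *\<^sub>v u)) = (W\<^sup>T *\<^sub>v e) \<bullet> (W\<^sup>T *\<^sub>v u)"
      proof -
        have "W \<in> carrier_mat m (dim_col W)" "W\<^sup>T *\<^sub>v u \<in> carrier_vec (dim_col W)" "e \<in> carrier_vec m"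
          using W(1) e by (auto intro: carrier_vecI)
        from transpose_vec_mult_scalar[OF this] show ?thesis by simp
      qed
      also have "\<dots> = 0" unfolding e(2) by (intro scalar_prod_left_zero carrier_vecI) simp
      finally have z: "e \<bullet> (W *\<^sub>v (W\<^sup>T *\<^sub>v u)) = 0" .
      have ec: "e \<in> carrier_vec m" "W *\<^sub>v (W\<^sup>T *\<^sub>v u) \<in> carrier_vec m"
        using e W(1) by (auto intro: carrier_vecI)
      have "e \<bullet> e = e \<bullet> u - e \<bullet> (W *\<^sub>v (W\<^sup>T *\<^sub>v u))"
        by (subst (2) e_def) (rule scalar_prod_minus_distrib[OF ec(1) u(1) ec(2)])
      then show ?thesis using z u ec by (simp add: f_def)
    qed
    have new: "W' *\<^sub>v (W'\<^sup>T *\<^sub>v u) = u"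
    proof (rule eq_vecI)
      fix i assume i: "i < dim_vec u"
      have "f $ i * (f \<bullet> u) = c * c * (e \<bullet> e) * e $ i"
        using i u e by (simp add: fu) (simp add: f_def mult_ac)
      also have "\<dots> = e $ i" using cc by simp
      also have "\<dots> = u $ i - (W *\<^sub>v (W\<^sup>T *\<^sub>v u)) $ i"
        using i u W(1) by (simp add: e_def del: index_mult_mat_vec)
      finally show "(W' *\<^sub>v (W'\<^sup>T *\<^sub>v u)) $ i = u $ i" using i u by (simp add: proj del: index_mult_mat_vec)
    qed (use W' u in auto)
    show ?thesis
      using W' W(2) orth old new by (intro exI[of _ W']) auto
  qed
qed

text \<open>Each term \<open>s i * (c i - [i < r])\<close> can only grow when \<open>s i\<close> is
  replaced by the threshold \<open>s r\<close>, since the bracket is nonpositive below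
  \<open>r\<close> and nonnegative from \<open>r\<close> on; the bracket then sums to at most 0. For
  \<open>r = n\<close> there is no threshold, and \<open>c i \<le> 1\<close> suffices.\<close>

lemma weighted_sum_le:
  fixes s c :: "nat \<Rightarrow> real"
  assumes mono: "\<And>i j. i \<le> j \<Longrightarrow> j < n \<Longrightarrow> s j \<le> s i" and s: "\<And>i. i < n \<Longrightarrow> 0 \<le> s i"
    and c: "\<And>i. i < n \<Longrightarrow> 0 \<le> c i" "\<And>i. i < n \<Longrightarrow> c i \<le> 1"
    and le: "(\<Sum>i<n. c i) \<le> real r" and r: "r \<le> n"
  shows "(\<Sum>i<n. s i * c i) \<le> (\<Sum>i<n. s i * (if i < r then 1 else 0))"
proof (cases "r = n")
  case True
  have "s i * c i \<le> s i * 1" if "i < n" for i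
    using that s c by (intro mult_left_mono) auto
  then show ?thesis using True by (intro sum_mono) auto
next
  case False
  then have rn: "r < n" using r by simp
  have "s i * (c i - (if i < r then 1 else 0)) \<le> s r * (c i - (if i < r then 1 else 0))" if i: "i < n" for i
  proof (cases "i < r")
    case True
    then show ?thesis using mono[of i r] rn c(2)[OF i] by (intro mult_right_mono_neg) auto
  next
    case False
    then show ?thesis using mono[of r i] i c(1)[OF i] by (auto intro: mult_right_mono)
  qed
  then have "(\<Sum>i<n. s i * (c i - (if i < r then 1 else 0))) \<le> (\<Sum>i<n. s r * (c i - (if i < r then 1 else 0)))"
    by (intro sum_mono) simp
  also have "\<dots> = s r * ((\<Sum>i<n. c i) - (\<Sum>i<n. if i < r then 1 else 0))"
    by (simp add: sum_distrib_left[symmetric] sum_subtractf)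
  also have "(\<Sum>i<n. if i < r then 1 else 0 :: real) = real r"
  proof -
    have "{..<n} \<inter> {i. i < r} = {..<r}" using rn by auto
    then show ?thesis by (simp add: sum.If_cases)
  qed
  also have "s r * ((\<Sum>i<n. c i) - real r) \<le> 0"
    using s[OF rn] le by (intro mult_nonneg_nonpos) auto
  finally show ?thesis by (simp add: right_diff_distrib sum_subtractf)
qed

text \<open>\<open>U\<close> is isometric, and \<open>S\<close> scales row \<open>i\<close> of
  \<open>V\<^sup>T B\<close> by the singular value. Padding with 0 beyond \<open>dim_row A\<close>
  lets the sum run over all right singular vectors.\<close>

lemma is_svd_mat_norm_mult:
  assumes svd: "is_svd A U S V" and B: "dim_row B = dim_col A"
  shows "(mat_norm (A * B))\<^sup>2 =
    (\<Sum>i<dim_col A. (if i < dim_row A then (S $$ (i, i))\<^sup>2 else 0) * (row (V\<^sup>T * B) i \<bullet> row (V\<^sup>T * B) i))"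
proof -
  let ?m = "dim_row A" and ?n = "dim_col A"
  have "U \<in> carrier_mat ?m ?m" "V \<in> carrier_mat ?n ?n" "S \<in> carrier_mat ?m ?n"
    and oU: "orthonormal_cols U" and dS: "diagonal_mat S" and A: "A = U * S * V\<^sup>T"
    using svd unfolding is_svd_def square_orthogonal_def by blast+
  then have U: "dim_row U = ?m" "dim_col U = ?m" and V: "dim_row V = ?n" "dim_col V = ?n"
    and S: "dim_row S = ?m" "dim_col S = ?n"
    by blast+
  define H where "H = V\<^sup>T * B"
  have H: "dim_row H = ?n" "dim_col H = dim_col B" using V by (auto simp: H_def)
  have "A * B = U * S * V\<^sup>T * B" by (subst A) (rule refl)
  also have "\<dots> = U * (S * H)"
    using U V S B by (simp add: H_def mult_mat_assoc)
  finally have "(mat_norm (A * B))\<^sup>2 = (mat_norm (S * H))\<^sup>2"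
    using U S oU by (simp add: mat_norm_mult_orthonormal_cols)
  also have "\<dots> = (\<Sum>j<dim_col B. \<Sum>i<?m. ((S * H) $$ (i, j))\<^sup>2)"
    using S H by (simp add: mat_norm_power2_cols scalar_prod_self_sum)
  also have "\<dots> = (\<Sum>j<dim_col B. \<Sum>i<?n. (if i < ?m then (S $$ (i, i))\<^sup>2 else 0) * (H $$ (i, j))\<^sup>2)"
  proof (rule sum.cong)
    fix j assume j: "j \<in> {..<dim_col B}"
    have SH: "(S * H) $$ (i, j) = (if i < ?n then S $$ (i, i) * H $$ (i, j) else 0)" if i: "i < ?m" for i
    proof -
      have "(S * H) $$ (i, j) = (\<Sum>k<?n. S $$ (i, k) * H $$ (k, j))"
        using i j S H by (simp add: scalar_prod_def atLeast0LessThan)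
      also have "\<dots> = (\<Sum>k<?n. if k = i then S $$ (i, i) * H $$ (i, j) else 0)"
        using S dS i by (intro sum.cong) (auto simp: diagonal_mat_def)
      also have "\<dots> = (if i < ?n then S $$ (i, i) * H $$ (i, j) else 0)" by simp
      finally show ?thesis .
    qed
    \<comment> \<open>Both sums reduce to the indices below \<open>?m\<close> and \<open>?n\<close>:
      the remaining rows of \<open>S * H\<close> vanish, and the remaining weights are the
      padding.\<close>
    have "(\<Sum>i<?m. ((S * H) $$ (i, j))\<^sup>2) = (\<Sum>i<?m. if i < ?n then (S $$ (i, i) * H $$ (i, j))\<^sup>2 else 0)"
      by (intro sum.cong) (auto simp: SH)
    also have "\<dots> = (\<Sum>i\<in>{..<?m} \<inter> {..<?n}. (S $$ (i, i) * H $$ (i, j))\<^sup>2)"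
      by (simp add: sum.If_cases lessThan_def)
    also have "\<dots> = (\<Sum>i\<in>{..<?n} \<inter> {..<?m}. (S $$ (i, i) * H $$ (i, j))\<^sup>2)"
      by (simp add: Int_commute)
    also have "\<dots> = (\<Sum>i<?n. if i < ?m then (S $$ (i, i) * H $$ (i, j))\<^sup>2 else 0)"
      by (simp add: sum.If_cases lessThan_def)
    also have "\<dots> = (\<Sum>i<?n. (if i < ?m then (S $$ (i, i))\<^sup>2 else 0) * (H $$ (i, j))\<^sup>2)"
      by (intro sum.cong) (auto simp: power_mult_distrib)
    finally show "(\<Sum>i<?m. ((S * H) $$ (i, j))\<^sup>2) =
      (\<Sum>i<?n. (if i < ?m then (S $$ (i, i))\<^sup>2 else 0) * (H $$ (i, j))\<^sup>2)" .
  qed simp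
  also have "\<dots> = (\<Sum>i<?n. \<Sum>j<dim_col B. (if i < ?m then (S $$ (i, i))\<^sup>2 else 0) * (H $$ (i, j))\<^sup>2)"
    by (rule sum.swap)
  also have "\<dots> = (\<Sum>i<?n. (if i < ?m then (S $$ (i, i))\<^sup>2 else 0) * (row H i \<bullet> row H i))"
    using H by (simp add: scalar_prod_self_sum sum_distrib_left)
  finally show ?thesis by (simp add: H_def)
qed

text \<open>Ky Fan's maximum principle. The squared lengths of the rows of
  \<open>V\<^sup>T W\<close> are weights for the squared singular values: at most 1 by Bessel, and
  of total \<open>dim_col W\<close> because \<open>V\<close> is orthogonal and \<open>W\<close> has
  orthonormal columns.\<close>

lemma is_svd_mat_norm_le:
  assumes svd: "is_svd A U S V" and r: "r \<le> dim_col A"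
    and W: "orthonormal_cols W" "dim_row W = dim_col A" "dim_col W \<le> r"
  shows "mat_norm (A * W) \<le> mat_norm (A * mat_of_cols (dim_col A) (take r (cols V)))"
proof -
  let ?m = "dim_row A" and ?n = "dim_col A"
  have V: "dim_row V = ?n" "dim_col V = ?n" "orthonormal_cols V" "V\<^sup>T * V = 1\<^sub>m ?n"
    and S: "\<And>i. i < min ?m ?n \<Longrightarrow> 0 \<le> S $$ (i, i)"
      "\<And>i j. i \<le> j \<Longrightarrow> j < min ?m ?n \<Longrightarrow> S $$ (j, j) \<le> S $$ (i, i)"
    using svd by (auto simp: is_svd_def square_orthogonal_def orthonormal_cols_def)
  have VVT: "V * V\<^sup>T = 1\<^sub>m ?n"
    using V by (intro mat_mult_left_right_inverse[of "V\<^sup>T"]) auto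
  define s where "s i = (if i < ?m then (S $$ (i, i))\<^sup>2 else 0)" for i
  define V1 where "V1 = mat_of_cols ?n (take r (cols V))"
  have V1: "dim_row V1 = ?n" "dim_col V1 = r" using V r by (auto simp: V1_def)
  have colV1: "col V1 j = col V j" if "j < r" for j
    using that V r unfolding V1_def by (subst col_mat_of_cols) (auto intro: carrier_vecI)
  define H where "H = V\<^sup>T * W"
  have H: "dim_row H = ?n" "dim_col H = dim_col W" using V by (auto simp: H_def)
  have "(mat_norm (A * W))\<^sup>2 = (\<Sum>i<?n. s i * (row H i \<bullet> row H i))"
    using is_svd_mat_norm_mult[OF svd W(2)] by (simp add: s_def H_def)
  also have "\<dots> \<le> (\<Sum>i<?n. s i * (if i < r then 1 else 0))"
  proof (rule weighted_sum_le)
    show "s j \<le> s i" if "i \<le> j" "j < ?n" for i j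
      using that S(1)[of j] S(2)[of i j] by (auto simp: s_def intro: power_mono)
    show "0 \<le> s i" for i by (simp add: s_def)
    show "0 \<le> row H i \<bullet> row H i" for i by (rule scalar_prod_self_nonneg)
    show "row H i \<bullet> row H i \<le> 1" if i: "i < ?n" for i
    proof -
      have "row H i = col (H\<^sup>T) i" using i H by simp
      also have "H\<^sup>T = W\<^sup>T * V" using V W by (simp add: H_def transpose_mult_dim)
      also have "col (W\<^sup>T * V) i = W\<^sup>T *\<^sub>v col V i" using i V by (simp add: col_mult_mat)
      finally have "row H i \<bullet> row H i \<le> col V i \<bullet> col V i"
        using Bessel_le[OF W(1), of "col V i"] V W by simp
      also have "\<dots> = 1"
        using arg_cong[OF V(4), of "\<lambda>A. A $$ (i, i)"] i V(1,2) by simp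
      finally show ?thesis .
    qed
    have "(\<Sum>i<?n. row H i \<bullet> row H i) = (mat_norm (H\<^sup>T))\<^sup>2"
      using H by (simp add: mat_norm_power2_cols)
    also have "mat_norm (H\<^sup>T) = mat_norm (V * H)"
      using mat_norm_mult_orthonormal_cols[OF V(3), of H] H V by (simp add: mat_norm_transpose)
    also have "V * H = W"
      using V W VVT mult_mat_assoc[of V "V\<^sup>T" W] by (simp add: H_def)
    also have "mat_norm W = mat_norm (1\<^sub>m (dim_col W))"
      using mat_norm_mult_orthonormal_cols[OF W(1), of "1\<^sub>m (dim_col W)"] by simp
    finally show "(\<Sum>i<?n. row H i \<bullet> row H i) \<le> real r"
      using W(3) by (simp add: mat_norm_one)
  qed (rule r)
  \<comment> \<open>For the leading singular vectors the weights are exactly 1 below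
    \<open>r\<close> and 0 afterwards, so the bound is attained.\<close>
  also have "\<dots> = (\<Sum>i<?n. s i * (row (V\<^sup>T * V1) i \<bullet> row (V\<^sup>T * V1) i))"
  proof (rule sum.cong)
    fix i assume i: "i \<in> {..<?n}"
    have "(V\<^sup>T * V1) $$ (i, j) = (if i = j then 1 else 0)" if j: "j < r" for j
      using arg_cong[OF V(4), of "\<lambda>A. A $$ (i, j)"] i j V(1,2) V1 r by (simp add: colV1)
    then have "row (V\<^sup>T * V1) i \<bullet> row (V\<^sup>T * V1) i = (\<Sum>j<r. (if i = j then 1 else 0)\<^sup>2)"
      using i V V1 by (simp add: scalar_prod_self_sum)
    also have "\<dots> = (\<Sum>j<r. if i = j then 1 else 0)" by (intro sum.cong) auto
    finally show "s i * (if i < r then 1 else 0) = s i * (row (V\<^sup>T * V1) i \<bullet> row (V\<^sup>T * V1) i)"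
      by simp
  qed simp
  also have "\<dots> = (mat_norm (A * V1))\<^sup>2"
    using is_svd_mat_norm_mult[OF svd V1(1)] by (simp add: s_def)
  finally show ?thesis
    unfolding V1_def by (rule power2_le_imp_le) (rule mat_norm_nonneg)
qed

text \<open>Let \<open>W\<close> have orthonormal columns whose span contains the rows of
  \<open>E\<close>. Subtracting \<open>C E\<close> does not affect the part of \<open>A\<close>
  orthogonal to \<open>W\<close>, so the squared error is at least that of \<open>A\<close> minus
  that of \<open>A W\<close>. By Ky Fan, \<open>A W\<close> is no larger than \<open>A V\<close>,
  and \<open>A Vp\<close> is what remains after removing \<open>A V\<close>.\<close>

lemma Eckart_Young:
  assumes V: "first_right_singular_vectors A r V" and Vp: "is_orth_compl V Vp"
    and C: "C \<in> carrier_mat (dim_row A) r" and E: "E \<in> carrier_mat r (dim_col A)"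
  shows "mat_norm (A * Vp) \<le> mat_norm (A - C * E)"
proof -
  let ?m = "dim_row A" and ?n = "dim_col A"
  have dCE: "dim_row C = ?m" "dim_col C = r" "dim_row E = r" "dim_col E = ?n" using C E by auto
  obtain U S V' where r: "r \<le> ?n" and svd: "is_svd A U S V'"
    and V_def: "V = mat_of_cols ?n (take r (cols V'))"
    using V by (auto simp: first_right_singular_vectors_def)
  have dV: "dim_row V = ?n" by (simp add: V_def)
  note compl = is_orth_complD[OF Vp]
  have "set (cols (E\<^sup>T)) \<subseteq> carrier_vec ?n"
    using cols_dim[of "E\<^sup>T"] dCE by simp
  from orthonormalize[OF this] obtain W where W: "dim_row W = ?n" "dim_col W \<le> r" "orthonormal_cols W"
    and WE: "\<And>v. v \<in> set (cols (E\<^sup>T)) \<Longrightarrow> W *\<^sub>v (W\<^sup>T *\<^sub>v v) = v"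
    using dCE by auto
  have WWE: "W * (W\<^sup>T * E\<^sup>T) = E\<^sup>T"
  proof (rule eq_matI)
    fix i j assume ij: "i < dim_row (E\<^sup>T)" "j < dim_col (E\<^sup>T)"
    then have "col (W * (W\<^sup>T * E\<^sup>T)) j = W *\<^sub>v (W\<^sup>T *\<^sub>v col (E\<^sup>T) j)"
      by (simp add: col_mult_mat)
    also have "\<dots> = col (E\<^sup>T) j"
      using ij by (intro WE) (auto simp: cols_def simp del: cols_transpose)
    finally have c: "col (W * (W\<^sup>T * E\<^sup>T)) j = col (E\<^sup>T) j" .
    have "(W * (W\<^sup>T * E\<^sup>T)) $$ (i, j) = col (W * (W\<^sup>T * E\<^sup>T)) j $ i"
      using ij W(1) dCE by simp
    also have "\<dots> = E\<^sup>T $$ (i, j)" unfolding c using ij by simp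
    finally show "(W * (W\<^sup>T * E\<^sup>T)) $$ (i, j) = E\<^sup>T $$ (i, j)" .
  qed (use W dCE in auto)
  \<comment> \<open>Transposed because \<open>W W\<^sup>T\<close> projects columns, while the factor
    \<open>E\<close> determines the rows of \<open>C * E\<close>.\<close>
  let ?M = "A\<^sup>T - E\<^sup>T * C\<^sup>T"
  have M: "dim_row ?M = ?n" "dim_col ?M = ?m" using dCE by auto
  have res: "?M - W * (W\<^sup>T * ?M) = A\<^sup>T - W * (W\<^sup>T * A\<^sup>T)"
  proof -
    have "W\<^sup>T * ?M = W\<^sup>T * A\<^sup>T - W\<^sup>T * (E\<^sup>T * C\<^sup>T)"
      using W dCE by (intro mult_minus_distrib_mat[of _ "dim_col W" ?n _ ?m]) auto
    then have "W * (W\<^sup>T * ?M) = W * (W\<^sup>T * A\<^sup>T - W\<^sup>T * (E\<^sup>T * C\<^sup>T))" by simp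
    also have "\<dots> = W * (W\<^sup>T * A\<^sup>T) - W * (W\<^sup>T * (E\<^sup>T * C\<^sup>T))"
      using W dCE by (intro mult_minus_distrib_mat[of _ ?n "dim_col W" _ ?m]) auto
    also have "W * (W\<^sup>T * (E\<^sup>T * C\<^sup>T)) = W * (W\<^sup>T * E\<^sup>T) * C\<^sup>T"
      using W dCE by (simp add: mult_mat_assoc)
    finally have "W * (W\<^sup>T * ?M) = W * (W\<^sup>T * A\<^sup>T) - E\<^sup>T * C\<^sup>T"
      by (simp add: WWE)
    then show ?thesis
      using W dCE by (intro eq_matI) (simp_all del: index_mult_mat(1))
  qed
  have normAV: "mat_norm (B\<^sup>T * A\<^sup>T) = mat_norm (A * B)" if "dim_row B = ?n" for B
    using that mat_norm_transpose[of "A * B"] by (simp add: transpose_mult_dim)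
  have "(mat_norm (A\<^sup>T))\<^sup>2 = (mat_norm (A * V))\<^sup>2 + (mat_norm (A * Vp))\<^sup>2"
    using mat_norm_power2_split[OF Vp, of "A\<^sup>T"] dV compl(1) by (simp add: normAV)
  moreover have "(mat_norm (A\<^sup>T))\<^sup>2 = (mat_norm (A * W))\<^sup>2 + (mat_norm (A\<^sup>T - W * (W\<^sup>T * A\<^sup>T)))\<^sup>2"
    using mat_norm_minus_projection[OF W(3), of "A\<^sup>T"] W(1) by (simp add: normAV)
  moreover have "mat_norm (A * W) \<le> mat_norm (A * V)"
    unfolding V_def using is_svd_mat_norm_le[OF svd r W(3) W(1) W(2)] .
  then have "(mat_norm (A * W))\<^sup>2 \<le> (mat_norm (A * V))\<^sup>2"
    by (intro power_mono mat_norm_nonneg)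
  moreover have "(mat_norm ?M)\<^sup>2 = (mat_norm (W\<^sup>T * ?M))\<^sup>2 + (mat_norm (A\<^sup>T - W * (W\<^sup>T * A\<^sup>T)))\<^sup>2"
    using mat_norm_minus_projection[OF W(3), of ?M] W(1) M res by simp
  moreover have "mat_norm ?M = mat_norm (A - C * E)"
  proof -
    have "?M = (A - C * E)\<^sup>T"
      using dCE by (simp add: transpose_mult_dim transpose_minus_dim)
    then show ?thesis by (simp add: mat_norm_transpose)
  qed
  ultimately have "(mat_norm (A * Vp))\<^sup>2 \<le> (mat_norm (A - C * E))\<^sup>2"
    by (smt (verit) zero_le_power2)
  then show ?thesis by (rule power2_le_imp_le) (rule mat_norm_nonneg)
qed

section \<open>Multi-indices and matricization\<close>

lemma finite_multi_indices: "finite I \<Longrightarrow> finite (multi_indices n I)"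
  unfolding multi_indices_def by (intro finite_PiE) auto

text \<open>\<open>colex\<close> is a left inverse, which gives injectivity; surjectivity follows by
  counting.\<close>

lemma bij_betw_colex_inv:
  assumes "finite I"
  shows "bij_betw (colex_inv n I) {..<size_of n I} (multi_indices n I)"
proof -
  have inj: "inj_on (colex_inv n I) {..<size_of n I}"
    by (rule inj_on_inverseI[of _ "colex n I"]) (simp add: colex_colex_inv_mod[OF assms])
  have sub: "colex_inv n I ` {..<size_of n I} \<subseteq> multi_indices n I"
  proof
    fix i assume "i \<in> colex_inv n I ` {..<size_of n I}"
    then obtain a where a: "a < size_of n I" and i: "i = colex_inv n I a" by auto
    \<comment> \<open>The remainder modulo \<open>n \<mu>\<close> is in range only for nonempty
      modes; the existence of a position \<open>a\<close> guarantees them.\<close>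
    have "n \<mu> > 0" if "\<mu> \<in> I" for \<mu>
    proof (rule gr0I)
      assume "n \<mu> = 0"
      then have "size_of n I = 0"
        unfolding size_of_def by (rule prod_zero[OF assms bexI[OF _ that]])
      with a show False by simp
    qed
    then show "i \<in> multi_indices n I"
      by (auto simp: i multi_indices_def colex_inv_def)
  qed
  have "card (multi_indices n I) = size_of n I"
    using assms by (simp add: multi_indices_def size_of_def card_PiE)
  then have "colex_inv n I ` {..<size_of n I} = multi_indices n I"
    using sub inj finite_multi_indices[OF assms]
    by (intro card_subset_eq) (simp_all add: card_image)
  with inj show ?thesis by (simp add: bij_betw_def)
qed

lemma
  assumes "finite I" "i \<in> multi_indices n I"
  shows colex_inv_colex: "colex_inv n I (colex n I i) = i"
    and colex_less: "colex n I i < size_of n I"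
proof -
  obtain a where "a < size_of n I" "i = colex_inv n I a"
    using bij_betw_colex_inv[OF assms(1), of n] assms(2) by (auto simp: bij_betw_def)
  then show "colex_inv n I (colex n I i) = i" "colex n I i < size_of n I"
    by (simp_all add: colex_colex_inv_mod[OF assms(1)])
qed

lemma colex_inv_in_multi_indices:
  "finite I \<Longrightarrow> a < size_of n I \<Longrightarrow> colex_inv n I a \<in> multi_indices n I"
  using bij_betw_colex_inv[of I n] by (auto simp: bij_betw_def)

lemma sum_colex_inv:
  "finite I \<Longrightarrow> (\<Sum>a<size_of n I. f (colex_inv n I a)) = (\<Sum>x\<in>multi_indices n I. f x)"
  by (rule sum.reindex_bij_betw[OF bij_betw_colex_inv])

lemma colex_cong: "(\<And>\<mu>. \<mu> \<in> I \<Longrightarrow> i \<mu> = j \<mu>) \<Longrightarrow> colex n I i = colex n I j"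
  unfolding colex_def by (rule sum.cong) auto

lemma restrict_multi_indices: "i \<in> multi_indices n D \<Longrightarrow> I \<subseteq> D \<Longrightarrow> restrict i I \<in> multi_indices n I"
  by (auto simp: multi_indices_def)

lemma join_in_multi_indices:
  "I \<subseteq> D \<Longrightarrow> x \<in> multi_indices n I \<Longrightarrow> i \<in> multi_indices n D \<Longrightarrow> join I x i \<in> multi_indices n D"
  by (auto simp: multi_indices_def join_def PiE_def Pi_def extensional_def)

lemma join_in_multi_indices':
  "I \<subseteq> D \<Longrightarrow> x \<in> multi_indices n I \<Longrightarrow> y \<in> multi_indices n (D - I) \<Longrightarrow> join I x y \<in> multi_indices n D"
  by (auto simp: multi_indices_def join_def PiE_def Pi_def extensional_def)

lemma sum_multi_indices_join:
  assumes "finite D" "I \<subseteq> D"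
  shows "(\<Sum>i\<in>multi_indices n D. f i) =
    (\<Sum>x\<in>multi_indices n I. \<Sum>y\<in>multi_indices n (D - I). f (join I x y))"
proof -
  have "(\<Sum>i\<in>multi_indices n D. f i) =
      (\<Sum>(x, y)\<in>multi_indices n I \<times> multi_indices n (D - I). f (join I x y))"
  proof (rule sum.reindex_bij_witness[where j = "\<lambda>i. (restrict i I, restrict i (D - I))"
        and i = "\<lambda>(x, y). join I x y"], goal_cases)
    case (1 i)
    then show ?case using assms(2)
      by (auto simp: join_def multi_indices_def PiE_def extensional_def)
  next
    case (2 i)
    then show ?case using assms(2) by (auto intro: restrict_multi_indices)
  next
    case (3 xy)
    then show ?case using assms(2)
      by (auto simp: join_def multi_indices_def PiE_def extensional_def fun_eq_iff)
  next
    case (4 xy)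
    then show ?case using assms(2) by (auto intro: join_in_multi_indices')
  next
    case (5 i)
    then show ?case using assms(2)
      by (auto simp: join_def multi_indices_def PiE_def extensional_def intro!: arg_cong[where f = f])
  qed
  then show ?thesis by (simp add: sum.cartesian_product)
qed

lemma matricize_carrier: "matricize n D I S \<in> carrier_mat (size_of n I) (size_of n (D - I))"
  by (simp add: matricize_def)

lemma dim_matricize [simp]:
  "dim_row (matricize n D I S) = size_of n I" "dim_col (matricize n D I S) = size_of n (D - I)"
  by (simp_all add: matricize_def)

text \<open>Tensors are total functions with arbitrary values off \<open>multi_indices n D\<close>,
  so identities between them are stated on that set; the congruence lemmas make this
  suffice.\<close>

lemma matricize_cong:
  assumes "finite D" "I \<subseteq> D" "\<And>i. i \<in> multi_indices n D \<Longrightarrow> S i = S' i"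
  shows "matricize n D I S = matricize n D I S'"
  using assms finite_subset[of I D]
  by (intro eq_matI)
    (auto simp: matricize_def intro!: assms(3) join_in_multi_indices' colex_inv_in_multi_indices)

lemma matricize_minus: "matricize n D I (S - S') = matricize n D I S - matricize n D I S'"
  by (intro eq_matI) (auto simp: matricize_def)

lemma frob_norm_L2_set: "frob_norm n D S = L2_set S (multi_indices n D)"
  by (simp add: frob_norm_def L2_set_def)

lemma frob_norm_cong:
  "(\<And>i. i \<in> multi_indices n D \<Longrightarrow> S i = S' i) \<Longrightarrow> frob_norm n D S = frob_norm n D S'"
  unfolding frob_norm_L2_set by (rule L2_set_cong) auto

text \<open>A matricization only rearranges the entries. Bounds obtained at different nodes thereby
  become bounds in one common norm.\<close>

lemma mat_norm_matricize:
  assumes "finite D" "I \<subseteq> D"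
  shows "mat_norm (matricize n D I S) = frob_norm n D S"
proof -
  have fin: "finite I" "finite (D - I)" using assms finite_subset by auto
  have "(\<Sum>i\<in>multi_indices n D. (S i)\<^sup>2) =
      (\<Sum>a<size_of n I. \<Sum>b<size_of n (D - I). (S (join I (colex_inv n I a) (colex_inv n (D - I) b)))\<^sup>2)"
    by (simp add: sum_multi_indices_join[OF assms] sum_colex_inv[OF fin(1), symmetric]
        sum_colex_inv[OF fin(2), symmetric])
  also have "\<dots> = (\<Sum>ij\<in>{..<size_of n I} \<times> {..<size_of n (D - I)}. (matricize n D I S $$ ij)\<^sup>2)"
    by (auto simp: sum.cartesian_product matricize_def intro!: sum.cong)
  finally show ?thesis
    by (simp add: mat_norm_def L2_set_def frob_norm_def)
qed

text \<open>A form without the column enumeration, in which operators belonging to different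
  matricizations can be composed.\<close>

lemma mode_apply_eq_sum:
  assumes D: "finite D" "I \<subseteq> D" and M: "M \<in> carrier_mat (size_of n I) (size_of n I)"
    and i: "i \<in> multi_indices n D"
  shows "mode_apply n D I M S i =
    (\<Sum>x\<in>multi_indices n I. M $$ (colex n I i, colex n I x) * S (join I x i))"
proof -
  have fin: "finite I" "finite (D - I)" using D finite_subset by auto
  define a where "a = colex n I i"
  define b where "b = colex n (D - I) i"
  have ab: "a = colex n I (restrict i I)" "b = colex n (D - I) (restrict i (D - I))"
    unfolding a_def b_def by (auto intro: colex_cong)
  have rI: "restrict i I \<in> multi_indices n I" "restrict i (D - I) \<in> multi_indices n (D - I)"
    using i D by (auto intro: restrict_multi_indices)
  have lt: "a < size_of n I" "b < size_of n (D - I)"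
    unfolding ab using rI fin by (auto intro: colex_less)
  have invb: "colex_inv n (D - I) b = restrict i (D - I)"
    unfolding ab using rI fin by (intro colex_inv_colex)
  have "mode_apply n D I M S i = (M * matricize n D I S) $$ (a, b)"
    by (simp add: mode_apply_def tensorize_def a_def b_def)
  also have "\<dots> = (\<Sum>c<size_of n I. M $$ (a, c) * matricize n D I S $$ (c, b))"
    using lt M by (simp add: scalar_prod_def atLeast0LessThan)
  also have "\<dots> = (\<Sum>c<size_of n I. M $$ (a, colex n I (colex_inv n I c)) *
      S (join I (colex_inv n I c) (restrict i (D - I))))"
    using lt by (intro sum.cong) (auto simp: matricize_def invb colex_colex_inv_mod[OF fin(1)])
  also have "\<dots> = (\<Sum>x\<in>multi_indices n I. M $$ (a, colex n I x) * S (join I x (restrict i (D - I))))"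
    by (rule sum_colex_inv[OF fin(1)])
  also have "\<dots> = (\<Sum>x\<in>multi_indices n I. M $$ (a, colex n I x) * S (join I x i))"
  proof (rule sum.cong)
    fix x assume "x \<in> multi_indices n I"
    \<comment> \<open>Off \<open>D\<close> the index \<open>i\<close> already has the default value
      that \<open>restrict\<close> inserts.\<close>
    have "join I x (restrict i (D - I)) = join I x i"
      using i by (auto simp: join_def multi_indices_def PiE_def extensional_def fun_eq_iff)
    then show "M $$ (a, colex n I x) * S (join I x (restrict i (D - I))) =
        M $$ (a, colex n I x) * S (join I x i)" by simp
  qed simp
  finally show ?thesis by (simp add: a_def)
qed

lemma mode_apply_cong:
  assumes "finite D" "I \<subseteq> D" "\<And>i. i \<in> multi_indices n D \<Longrightarrow> S i = S' i"
  shows "mode_apply n D I M S = mode_apply n D I M S'"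
  unfolding mode_apply_def using matricize_cong[OF assms] by simp

text \<open>Replacing the modes in \<open>I\<close> leaves the position in \<open>J\<close>
  unchanged and vice versa, as the sets are disjoint. Each coefficient then depends only on its own
  modes, and the sums may be swapped.\<close>

lemma mode_apply_commute:
  assumes D: "finite D" "I \<subseteq> D" "J \<subseteq> D" "I \<inter> J = {}"
    and M: "M \<in> carrier_mat (size_of n I) (size_of n I)"
    and N: "N \<in> carrier_mat (size_of n J) (size_of n J)"
    and i: "i \<in> multi_indices n D"
  shows "mode_apply n D I M (mode_apply n D J N S) i = mode_apply n D J N (mode_apply n D I M S) i"
proof -
  have "mode_apply n D I M (mode_apply n D J N S) i =
      (\<Sum>x\<in>multi_indices n I. \<Sum>y\<in>multi_indices n J. M $$ (colex n I i, colex n I x) *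
        (N $$ (colex n J (join I x i), colex n J y) * S (join J y (join I x i))))"
    using D i by (simp add: mode_apply_eq_sum[OF D(1,2) M] mode_apply_eq_sum[OF D(1,3) N]
        join_in_multi_indices sum_distrib_left)
  also have "\<dots> = (\<Sum>x\<in>multi_indices n I. \<Sum>y\<in>multi_indices n J. N $$ (colex n J i, colex n J y) *
        (M $$ (colex n I (join J y i), colex n I x) * S (join I x (join J y i))))"
  proof (intro sum.cong refl)
    fix x y
    have "colex n J (join I x i) = colex n J i" "colex n I (join J y i) = colex n I i"
      using D(4) by (auto simp: join_def intro!: colex_cong)
    moreover have "join J y (join I x i) = join I x (join J y i)"
      using D(4) by (auto simp: join_def fun_eq_iff)
    ultimately show "M $$ (colex n I i, colex n I x) *
        (N $$ (colex n J (join I x i), colex n J y) * S (join J y (join I x i))) =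
      N $$ (colex n J i, colex n J y) *
        (M $$ (colex n I (join J y i), colex n I x) * S (join I x (join J y i)))"
      by simp
  qed
  also have "\<dots> = (\<Sum>y\<in>multi_indices n J. \<Sum>x\<in>multi_indices n I. N $$ (colex n J i, colex n J y) *
        (M $$ (colex n I (join J y i), colex n I x) * S (join I x (join J y i))))"
    by (rule sum.swap)
  also have "\<dots> = mode_apply n D J N (mode_apply n D I M S) i"
    using D i by (simp add: mode_apply_eq_sum[OF D(1,2) M] mode_apply_eq_sum[OF D(1,3) N]
        join_in_multi_indices sum_distrib_left)
  finally show ?thesis .
qed

text \<open>Moves an operator from the innermost place, where \<open>foldr\<close> puts the last
  list element, to the outermost.\<close>

lemma foldr_mode_apply_commute:
  assumes D: "finite D" and I: "\<And>k. k \<in> insert x (set xs) \<Longrightarrow> I k \<subseteq> D"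
    and M: "\<And>k. k \<in> insert x (set xs) \<Longrightarrow> M k \<in> carrier_mat (size_of n (I k)) (size_of n (I k))"
    and disj: "\<And>k. k \<in> set xs \<Longrightarrow> I k \<inter> I x = {}"
    and i: "i \<in> multi_indices n D"
  shows "foldr (\<lambda>k. mode_apply n D (I k) (M k)) xs (mode_apply n D (I x) (M x) S) i =
    mode_apply n D (I x) (M x) (foldr (\<lambda>k. mode_apply n D (I k) (M k)) xs S) i"
  using I M disj i
proof (induction xs arbitrary: i)
  case Nil
  then show ?case by simp
next
  case (Cons y ys)
  let ?f = "\<lambda>k. mode_apply n D (I k) (M k)"
  \<comment> \<open>The induction hypothesis holds on multi-indices only, hence the congruence
    rule.\<close>
  have "?f y (foldr ?f ys (?f x S)) = ?f y (?f x (foldr ?f ys S))"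
    using Cons.prems by (intro mode_apply_cong D Cons.IH) auto
  then have "foldr ?f (y # ys) (?f x S) i = ?f y (?f x (foldr ?f ys S)) i" by simp
  also have "\<dots> = ?f x (?f y (foldr ?f ys S)) i"
    using Cons.prems by (intro mode_apply_commute D) auto
  finally show ?case by simp
qed

section \<open>Tree tensor networks\<close>

lemma index_tree_child:
  assumes tree: "is_index_tree D t" and k: "(Suc l, k) \<in> nodes t"
  shows "(l, parent t (Suc l) k) \<in> nodes t" "k \<in> children t l (parent t (Suc l) k)"
    "node t (Suc l) k \<subseteq> node t l (parent t (Suc l) k)"
proof -
  let ?p = "parent t (Suc l) k"
  have "(Suc l, k) \<in> nonroot_nodes t" using k by (simp add: nonroot_nodes_def)
  then have "(Suc l - 1, ?p) \<in> nodes t" using tree unfolding is_index_tree_def by blast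
  then show p: "(l, ?p) \<in> nodes t" by simp
  show c: "k \<in> children t l ?p" using k by (simp add: children_def)
  show "node t (Suc l) k \<subseteq> node t l ?p"
    using tree p c unfolding is_index_tree_def by blast
qed

lemma index_tree_root:
  assumes "is_index_tree D t" "(0, k) \<in> nodes t"
  shows "k = 1" "node t 0 k = D"
proof -
  have "width t 0 = 1" "node t 0 1 = D"
    using assms(1) unfolding is_index_tree_def by blast+
  then show "k = 1" "node t 0 k = D"
    using assms(2) by (auto simp: nodes_def)
qed

lemma index_tree_node_subset:
  assumes "is_index_tree D t" "(l, k) \<in> nodes t"
  shows "node t l k \<subseteq> D"
proof -
  have "\<forall>(l, k) \<in> nodes t. node t l k \<noteq> {} \<and> node t l k \<subseteq> D"
    using assms(1) unfolding is_index_tree_def by (elim conjE)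
  from bspec[OF this assms(2)] show ?thesis by simp
qed

lemma index_tree_siblings_disjoint:
  assumes "is_index_tree D t" "(l, p) \<in> nodes t" "j \<in> children t l p" "k \<in> children t l p" "j \<noteq> k"
  shows "node t (Suc l) j \<inter> node t (Suc l) k = {}"
proof -
  have "\<forall>(l, k) \<in> nodes t. (\<Union>j\<in>children t l k. node t (Suc l) j) \<subseteq> node t l k \<and>
      (\<forall>j\<in>children t l k. \<forall>j'\<in>children t l k.
         j \<noteq> j' \<longrightarrow> node t (Suc l) j \<inter> node t (Suc l) j' = {})"
    using assms(1) unfolding is_index_tree_def by (elim conjE)
  from bspec[OF this assms(2)] show ?thesis using assms(3-5) by simp
qed

text \<open>The definition of a tree separates siblings only. Nodes with different parents are
  contained in these parents, which are disjoint by induction.\<close>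

lemma index_tree_level_disjoint:
  assumes tree: "is_index_tree D t" and "(l, j) \<in> nodes t" "(l, k) \<in> nodes t" "j \<noteq> k"
  shows "node t l j \<inter> node t l k = {}"
  using assms(2-)
proof (induction l arbitrary: j k)
  case 0
  then show ?case using index_tree_root(1)[OF tree] by metis
next
  case (Suc l)
  note j = index_tree_child[OF tree Suc.prems(1)] and k = index_tree_child[OF tree Suc.prems(2)]
  show ?case
  proof (cases "parent t (Suc l) j = parent t (Suc l) k")
    case True
    then show ?thesis
      using index_tree_siblings_disjoint[OF tree k(1) _ k(2) Suc.prems(3)] j(2) by simp
  next
    case False
    then show ?thesis using Suc.IH[OF j(1) k(1)] j(3) k(3) by blast
  qed
qed

lemma finite_children: "finite (children t l k)"
proof (rule finite_subset)
  show "children t l k \<subseteq> {1..width t (Suc l)}" by (auto simp: children_def nodes_def)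
qed simp

text \<open>Isolates the summation index of one child \<open>k\<close>, so that its factor can be
  pulled out of the network contraction.\<close>

lemma sum_PiE_fibres:
  fixes f :: "('a \<Rightarrow> nat) \<Rightarrow> real"
  assumes "finite A" "k \<in> A"
  shows "(\<Sum>c\<in>PiE A (\<lambda>s. {..<r s}). f c) = (\<Sum>b<r k. \<Sum>c\<in>{c \<in> PiE A (\<lambda>s. {..<r s}). c k = b}. f c)"
proof (rule sum.group[symmetric])
  show "finite (PiE A (\<lambda>s. {..<r s}))" using assms(1) by (rule finite_PiE) simp
  show "(\<lambda>c. c k) ` PiE A (\<lambda>s. {..<r s}) \<subseteq> {..<r k}"
    using assms(2) by (auto dest: PiE_mem)
qed simp

text \<open>Going down the tree, all factors of the network other than \<open>U l k\<close> are collected in \<open>G\<close>,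
  which only depends on the modes outside the node.\<close>
lemma ttn_node_expansion:
  fixes U :: "nat \<Rightarrow> nat \<Rightarrow> real mat"
  assumes D: "finite D" and tree: "is_index_tree D t"
    and root: "U 0 1 = matricize n D D S"
    and inner: "\<And>l k. (l, k) \<in> nodes t \<Longrightarrow> children t l k \<noteq> {} \<Longrightarrow>
      \<exists>B :: (nat \<Rightarrow> nat) \<Rightarrow> multi_index \<Rightarrow> nat \<Rightarrow> real.
        \<forall>i \<in> multi_indices n (node t l k). \<forall>a < root_one r l k.
          U l k $$ (colex n (node t l k) i, a) =
            (\<Sum>c \<in> PiE (children t l k) (\<lambda>s. {..<root_one r (Suc l) s}).
               (\<Prod>s\<in>children t l k. U (Suc l) s $$ (colex n (node t (Suc l) s) i, c s)) *
               B c (restrict i (node t l k - (\<Union>s\<in>children t l k. node t (Suc l) s))) a)"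
    and k: "(l, k) \<in> nodes t"
  shows "\<exists>G :: nat \<Rightarrow> multi_index \<Rightarrow> real.
    (\<forall>a i i'. (\<forall>\<mu>\<in>D - node t l k. i \<mu> = i' \<mu>) \<longrightarrow> G a i = G a i') \<and>
    (\<forall>i\<in>multi_indices n D. S i =
      (\<Sum>a<root_one r l k. U l k $$ (colex n (node t l k) i, a) * G a i))"
  using k
proof (induction l arbitrary: k)
  case 0
  note k = index_tree_root[OF tree 0]
  have "S i = U 0 1 $$ (colex n D i, 0)" if i: "i \<in> multi_indices n D" for i
  proof -
    \<comment> \<open>At the root the column index ranges over no modes: its only value is the empty
      multi-index at position 0.\<close>
    have "join D i y = i" if "y = colex_inv n {} 0" for y
      using i that by (auto simp: join_def fun_eq_iff colex_inv_def multi_indices_def PiE_def extensional_def)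
    then show ?thesis
      using colex_less[OF D i] colex_inv_colex[OF D i]
      unfolding root by (simp add: matricize_def size_of_def)
  qed
  then show ?case
    using k by (intro exI[of _ "\<lambda>_ _. 1"]) (simp add: root_one_def)
next
  case (Suc l)
  define p where "p = parent t (Suc l) k"
  define ch where "ch = children t l p"
  define I where "I = node t l p"
  define N where "N s = node t (Suc l) s" for s
  define J where "J = I - (\<Union>s\<in>ch. N s)"
  define R where "R s = root_one r (Suc l) s" for s
  note child = index_tree_child[OF tree Suc.prems, folded p_def]
  have kch: "k \<in> ch" and fin: "finite ch" using child(2) by (simp_all add: ch_def finite_children)
  have Nsub: "N s \<subseteq> I" if "s \<in> ch" for s
  proof -
    have "(Suc l, s) \<in> nodes t" "parent t (Suc l) s = p" using that by (simp_all add: ch_def children_def)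
    then show ?thesis using index_tree_child(3)[OF tree, of l s] by (simp add: N_def I_def)
  qed
  have ID: "I \<subseteq> D" using index_tree_node_subset[OF tree child(1)] by (simp add: I_def)
  have disj: "N s \<inter> N k = {}" if "s \<in> ch" "s \<noteq> k" for s
    using index_tree_siblings_disjoint[OF tree child(1)] that kch by (simp add: ch_def N_def)
  obtain G where G: "\<And>a i i'. (\<forall>\<mu>\<in>D - I. i \<mu> = i' \<mu>) \<Longrightarrow> G a i = G a i'"
    and SG: "\<And>i. i \<in> multi_indices n D \<Longrightarrow>
      S i = (\<Sum>a<root_one r l p. U l p $$ (colex n I i, a) * G a i)"
    using Suc.IH[OF child(1)] unfolding I_def by blast
  obtain B :: "(nat \<Rightarrow> nat) \<Rightarrow> multi_index \<Rightarrow> nat \<Rightarrow> real" where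
    "\<forall>i \<in> multi_indices n I. \<forall>a < root_one r l p. U l p $$ (colex n I i, a) =
       (\<Sum>c \<in> PiE ch (\<lambda>s. {..<R s}).
          (\<Prod>s\<in>ch. U (Suc l) s $$ (colex n (N s) i, c s)) * B c (restrict i J) a)"
    using inner[OF child(1)] kch unfolding ch_def I_def N_def J_def R_def by blast
  then have B: "U l p $$ (colex n I i, a) =
       (\<Sum>c \<in> PiE ch (\<lambda>s. {..<R s}).
          (\<Prod>s\<in>ch. U (Suc l) s $$ (colex n (N s) i, c s)) * B c (restrict i J) a)"
    if "i \<in> multi_indices n I" "a < root_one r l p" for i a
    using that by blast
  \<comment> \<open>\<open>H\<close> absorbs the transfer array and the context of the parent;
    \<open>G'\<close> adds the factors of the siblings with the index of child \<open>k\<close>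
    fixed to \<open>b\<close>. Neither sees the modes of \<open>k\<close>: the leftover set
    \<open>J\<close> excludes them, and siblings are disjoint.\<close>
  define H where "H c i = (\<Sum>a<root_one r l p. B c (restrict i J) a * G a i)" for c i
  define G' where "G' b i = (\<Sum>c\<in>{c \<in> PiE ch (\<lambda>s. {..<R s}). c k = b}.
    (\<Prod>s\<in>ch - {k}. U (Suc l) s $$ (colex n (N s) i, c s)) * H c i)" for b i
  have "G' b i = G' b i'" if eq: "\<forall>\<mu>\<in>D - N k. i \<mu> = i' \<mu>" for b i i'
  proof -
    have "G a i = G a i'" for a
      using eq Nsub[OF kch] by (intro G) auto
    moreover have "restrict i J = restrict i' J"
      using eq kch ID by (auto simp: J_def fun_eq_iff)
    ultimately have "H c i = H c i'" for c by (simp add: H_def)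
    moreover have "colex n (N s) i = colex n (N s) i'" if "s \<in> ch - {k}" for s
      using that eq disj[of s] Nsub[of s] ID by (intro colex_cong) blast
    ultimately show ?thesis by (simp add: G'_def)
  qed
  moreover have "S i = (\<Sum>b<R k. U (Suc l) k $$ (colex n (N k) i, b) * G' b i)"
    if i: "i \<in> multi_indices n D" for i
  proof -
    let ?u = "\<lambda>s c. U (Suc l) s $$ (colex n (N s) i, c s)"
    have iI: "restrict i I \<in> multi_indices n I" using i ID by (rule restrict_multi_indices)
    have "U l p $$ (colex n I i, a) =
      (\<Sum>c \<in> PiE ch (\<lambda>s. {..<R s}). (\<Prod>s\<in>ch. ?u s c) * B c (restrict i J) a)"
      if a: "a < root_one r l p" for a
    proof -
      have "colex n I (restrict i I) = colex n I i" by (auto intro: colex_cong)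
      moreover have "colex n (N s) (restrict i I) = colex n (N s) i" if "s \<in> ch" for s
        using Nsub[OF that] by (intro colex_cong) auto
      moreover have "restrict (restrict i I) J = restrict i J"
        by (auto simp: J_def fun_eq_iff)
      ultimately show ?thesis using B[OF iI a] by simp
    qed
    then have "S i = (\<Sum>a<root_one r l p.
        (\<Sum>c \<in> PiE ch (\<lambda>s. {..<R s}). (\<Prod>s\<in>ch. ?u s c) * B c (restrict i J) a) * G a i)"
      by (simp add: SG[OF i])
    also have "\<dots> = (\<Sum>c \<in> PiE ch (\<lambda>s. {..<R s}). \<Sum>a<root_one r l p.
        (\<Prod>s\<in>ch. ?u s c) * B c (restrict i J) a * G a i)"
      unfolding sum_distrib_right by (rule sum.swap)
    also have "\<dots> = (\<Sum>c \<in> PiE ch (\<lambda>s. {..<R s}). (\<Prod>s\<in>ch. ?u s c) * H c i)"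
      by (simp add: H_def sum_distrib_left mult.assoc)
    also have "\<dots> = (\<Sum>b<R k. \<Sum>c\<in>{c \<in> PiE ch (\<lambda>s. {..<R s}). c k = b}. (\<Prod>s\<in>ch. ?u s c) * H c i)"
      by (rule sum_PiE_fibres[OF fin kch])
    also have "\<dots> = (\<Sum>b<R k. U (Suc l) k $$ (colex n (N k) i, b) * G' b i)"
      unfolding G'_def sum_distrib_left prod.remove[OF fin kch]
      by (intro sum.cong refl) (auto simp: mult.assoc)
    finally show ?thesis .
  qed
  ultimately show ?case unfolding N_def R_def by blast
qed

text \<open>In the expansion at the node, \<open>U l k\<close> depends on the row index only. The
  context \<open>G\<close> ignores the modes of the node, hence depends on the column index only and
  yields the second factor.\<close>

lemma has_ttn_rank_matricize:
  assumes D: "finite D" and tree: "is_index_tree D t"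
    and S: "has_ttn_rank n D t r S" and k: "(l, k) \<in> nodes t"
  shows "\<exists>C\<in>carrier_mat (size_of n (node t l k)) (root_one r l k).
    \<exists>E\<in>carrier_mat (root_one r l k) (size_of n (D - node t l k)).
      matricize n D (node t l k) S = C * E"
proof -
  let ?I = "node t l k" and ?r = "root_one r l k"
  have ID: "?I \<subseteq> D" by (rule index_tree_node_subset[OF tree k])
  have fin: "finite ?I" "finite (D - ?I)" using D ID finite_subset by auto
  obtain U where U: "\<And>l k. (l, k) \<in> nodes t \<Longrightarrow> U l k \<in> carrier_mat (size_of n (node t l k)) (root_one r l k)"
    and root: "U 0 1 = matricize n D D S"
    and inner: "\<And>l k. (l, k) \<in> nodes t \<Longrightarrow> children t l k \<noteq> {} \<Longrightarrow>
      \<exists>B :: (nat \<Rightarrow> nat) \<Rightarrow> multi_index \<Rightarrow> nat \<Rightarrow> real.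
        \<forall>i \<in> multi_indices n (node t l k). \<forall>a < root_one r l k.
          U l k $$ (colex n (node t l k) i, a) =
            (\<Sum>c \<in> PiE (children t l k) (\<lambda>s. {..<root_one r (Suc l) s}).
               (\<Prod>s\<in>children t l k. U (Suc l) s $$ (colex n (node t (Suc l) s) i, c s)) *
               B c (restrict i (node t l k - (\<Union>s\<in>children t l k. node t (Suc l) s))) a)"
    using S unfolding has_ttn_rank_def by fast
  obtain G where G: "\<And>a i i'. (\<forall>\<mu>\<in>D - ?I. i \<mu> = i' \<mu>) \<Longrightarrow> G a i = G a i'"
    and SG: "\<And>i. i \<in> multi_indices n D \<Longrightarrow> S i = (\<Sum>a<?r. U l k $$ (colex n ?I i, a) * G a i)"
    using ttn_node_expansion[OF D tree root inner k] by blast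
  define E where "E = mat ?r (size_of n (D - ?I)) (\<lambda>(a, b). G a (colex_inv n (D - ?I) b))"
  have E: "E \<in> carrier_mat ?r (size_of n (D - ?I))" by (simp add: E_def)
  have "matricize n D ?I S = U l k * E"
  proof (rule eq_matI)
    fix a b assume "a < dim_row (U l k * E)" "b < dim_col (U l k * E)"
    then have ab: "a < size_of n ?I" "b < size_of n (D - ?I)" using U[OF k] E by auto
    let ?x = "colex_inv n ?I a" and ?y = "colex_inv n (D - ?I) b"
    have i: "join ?I ?x ?y \<in> multi_indices n D"
      using ab fin ID by (intro join_in_multi_indices' colex_inv_in_multi_indices)
    have "colex n ?I (join ?I ?x ?y) = colex n ?I ?x" by (auto simp: join_def intro: colex_cong)
    also have "\<dots> = a" using ab fin by (simp add: colex_colex_inv_mod)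
    finally have cx: "colex n ?I (join ?I ?x ?y) = a" .
    have "G c (join ?I ?x ?y) = G c ?y" for c by (rule G) (auto simp: join_def)
    then have "matricize n D ?I S $$ (a, b) = (\<Sum>c<?r. U l k $$ (a, c) * G c ?y)"
      using ab SG[OF i] by (simp add: matricize_def cx)
    also have "\<dots> = (U l k * E) $$ (a, b)"
      using ab U[OF k] by (simp add: E_def scalar_prod_def atLeast0LessThan)
    finally show "matricize n D ?I S $$ (a, b) = (U l k * E) $$ (a, b)" .
  qed (use U[OF k] E in auto)
  then show ?thesis using U[OF k] E by blast
qed

section \<open>Accumulation of the error\<close>

lemma sketch_proj_carrier:
  assumes "dim_row Y = dim_row A"
  shows "sketch_proj A X Y \<in> carrier_mat (dim_row A) (dim_row A)"
  using assms by (auto simp: sketch_proj_def intro: carrier_matI)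

text \<open>The bound \<open>h\<close> is required for all tensors but the residual only at
  \<open>T\<close>, where the sketch was taken. With \<open>h\<close> and \<open>e\<close> abstract,
  the accumulation is plain arithmetic.\<close>

lemma mode_apply_residual_le:
  assumes D: "finite D" "I \<subseteq> D" and P: "P \<in> carrier_mat (size_of n I) (size_of n I)"
    and bound: "\<And>S. mat_norm (P * matricize n D I S) \<le> h * mat_norm (matricize n D I S)"
    and residual: "mat_norm (matricize n D I T - P * matricize n D I T) \<le> e"
  shows "frob_norm n D (T - mode_apply n D I P S) \<le> h * frob_norm n D (T - S) + e"
proof -
  let ?m = "matricize n D I"
  have "frob_norm n D (T - mode_apply n D I P S) = mat_norm (?m T - P * ?m S)"
    by (simp add: mat_norm_matricize[OF D, symmetric] matricize_minus matricize_mode_apply[OF D P])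
  also have "?m T - P * ?m S = (?m T - P * ?m T) + P * ?m (T - S)"
  proof -
    have "P * ?m (T - S) = P * ?m T - P * ?m S"
      unfolding matricize_minus
      using P by (intro mult_minus_distrib_mat[OF P matricize_carrier matricize_carrier])
    then show ?thesis using P by (intro eq_matI) (simp_all del: index_mult_mat(1))
  qed
  also have "mat_norm \<dots> \<le> mat_norm (?m T - P * ?m T) + mat_norm (P * ?m (T - S))"
    using P by (intro mat_norm_triangle) auto
  also have "\<dots> \<le> e + h * mat_norm (?m (T - S))"
    by (intro add_mono residual bound)
  finally show ?thesis by (simp only: mat_norm_matricize[OF D] add.commute)
qed

text \<open>The operators of one level commute, so the one with the largest index may be taken to act
  last; its bound \<open>h\<close> then multiplies all the other errors.\<close>
lemma level_error_le:
  assumes D: "finite D" and I: "\<And>k. k \<in> {1..w} \<Longrightarrow> I k \<subseteq> D"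
    and P: "\<And>k. k \<in> {1..w} \<Longrightarrow> P k \<in> carrier_mat (size_of n (I k)) (size_of n (I k))"
    and disj: "\<And>j k. j \<in> {1..w} \<Longrightarrow> k \<in> {1..w} \<Longrightarrow> j \<noteq> k \<Longrightarrow> I j \<inter> I k = {}"
    and h: "\<And>k. k \<in> {1..w} \<Longrightarrow> 0 \<le> h k"
    and step: "\<And>k S. k \<in> {1..w} \<Longrightarrow>
      frob_norm n D (T - mode_apply n D (I k) (P k) S) \<le> h k * frob_norm n D (T - S) + e k"
  shows "frob_norm n D (T - foldr (\<lambda>k. mode_apply n D (I k) (P k)) [1..<Suc w] S) \<le>
    (\<Prod>j = 1..w. h j) * frob_norm n D (T - S) + (\<Sum>k = 1..w. e k * (\<Prod>j = k + 1..w. h j))"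
  using I P disj h step
proof (induction w)
  case 0
  then show ?case by simp
next
  case (Suc w)
  let ?f = "\<lambda>k. mode_apply n D (I k) (P k)" and ?F = "\<lambda>w. foldr (\<lambda>k. mode_apply n D (I k) (P k)) [1..<Suc w] S"
  have "?F (Suc w) i = ?f (Suc w) (?F w) i" if "i \<in> multi_indices n D" for i
  proof -
    \<comment> \<open>In the \<open>foldr\<close> the operator with index \<open>Suc w\<close> acts
      first on \<open>S\<close>; products over \<open>j > k\<close> arise only if it acts
      last.\<close>
    have "foldr ?f [1..<Suc w] (?f (Suc w) S) i = ?f (Suc w) (?F w) i"
    proof (rule foldr_mode_apply_commute[OF D])
      fix k assume "k \<in> insert (Suc w) (set [1..<Suc w])"
      then have k: "k \<in> {1..Suc w}" by auto
      show "I k \<subseteq> D" "P k \<in> carrier_mat (size_of n (I k)) (size_of n (I k))"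
        using Suc.prems(1,2)[OF k] by auto
    next
      fix k assume "k \<in> set [1..<Suc w]"
      then show "I k \<inter> I (Suc w) = {}" by (intro Suc.prems(3)) auto
    qed (rule that)
    then show ?thesis by simp
  qed
  then have "frob_norm n D (T - ?F (Suc w)) = frob_norm n D (T - ?f (Suc w) (?F w))"
    by (intro frob_norm_cong) simp
  also have "\<dots> \<le> h (Suc w) * frob_norm n D (T - ?F w) + e (Suc w)"
    by (rule Suc.prems(5)) simp
  also have "\<dots> \<le> h (Suc w) * ((\<Prod>j = 1..w. h j) * frob_norm n D (T - S) +
      (\<Sum>k = 1..w. e k * (\<Prod>j = k + 1..w. h j))) + e (Suc w)"
    using Suc.prems by (intro add_right_mono mult_left_mono Suc.IH) auto
  also have "\<dots> = (\<Prod>j = 1..Suc w. h j) * frob_norm n D (T - S) +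
      ((\<Sum>k = 1..w. e k * (\<Prod>j = k + 1..w. h j) * h (Suc w)) + e (Suc w))"
    by (simp add: algebra_simps sum_distrib_left)
  also have "(\<Sum>k = 1..w. e k * (\<Prod>j = k + 1..w. h j) * h (Suc w)) + e (Suc w) =
      (\<Sum>k = 1..Suc w. e k * (\<Prod>j = k + 1..Suc w. h j))"
  proof -
    \<comment> \<open>The factor \<open>h (Suc w)\<close> extends each product since
      \<open>k \<le> w\<close>; the new summand at \<open>Suc w\<close> carries an empty
      product.\<close>
    have "e k * (\<Prod>j = k + 1..w. h j) * h (Suc w) = e k * (\<Prod>j = k + 1..Suc w. h j)"
      if "k \<in> {1..w}" for k
      using that by (simp add: prod.nat_ivl_Suc' mult_ac)
    then have "(\<Sum>k = 1..w. e k * (\<Prod>j = k + 1..w. h j) * h (Suc w)) =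
        (\<Sum>k = 1..w. e k * (\<Prod>j = k + 1..Suc w. h j))"
      by (rule sum.cong[OF refl])
    then show ?thesis by simp
  qed
  finally show ?case .
qed

text \<open>\<open>VX_rank\<close> and \<open>YQ_rank\<close> make the two pseudoinverses one-sided
  inverses, a genericity condition implicit in the sketching. If all \<open>X l k\<close> were zero
  and a nonzero \<open>\<T>\<close> had TTN rank \<open>rh\<close>, the approximant would be zero
  (with at least one non-root node), while the right-hand side vanishes.\<close>

theorem theorem6p4:
  fixes d :: nat and n :: "nat \<Rightarrow> nat" and D :: "nat set"
    and \<I> :: index_tree
    and r p rh :: "nat \<Rightarrow> nat \<Rightarrow> nat"
    and \<T> \<T>h :: tensor
    and X Y Vh Vhp Q Qp :: "nat \<Rightarrow> nat \<Rightarrow> real mat"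
    and \<rho> \<tau> \<eta> :: "nat \<Rightarrow> nat \<Rightarrow> real"
  assumes D: "D = {1..d}"
    and dims: "\<And>\<mu>. \<mu> \<in> D \<Longrightarrow> 1 \<le> n \<mu>"
    and tree: "is_index_tree D \<I>"
    and r_pos: "\<And>l k. (l, k) \<in> nonroot_nodes \<I> \<Longrightarrow> 1 \<le> r l k"
    and X: "\<And>l k. (l, k) \<in> nonroot_nodes \<I> \<Longrightarrow>
        X l k \<in> carrier_mat (size_of n (D - node \<I> l k)) (r l k)"
    and Y: "\<And>l k. (l, k) \<in> nonroot_nodes \<I> \<Longrightarrow>
        Y l k \<in> carrier_mat (size_of n (node \<I> l k)) (r l k + p l k)"
    and rh_pos: "\<And>l k. (l, k) \<in> nonroot_nodes \<I> \<Longrightarrow> 1 \<le> rh l k"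
    and rh_less: "\<And>l k. (l, k) \<in> nonroot_nodes \<I> \<Longrightarrow> rh l k < r l k"
    and Vh: "\<And>l k. (l, k) \<in> nonroot_nodes \<I> \<Longrightarrow>
        first_right_singular_vectors (matricize n D (node \<I> l k) \<T>) (rh l k) (Vh l k)"
    and Vhp: "\<And>l k. (l, k) \<in> nonroot_nodes \<I> \<Longrightarrow> is_orth_compl (Vh l k) (Vhp l k)"
    and Q: "\<And>l k. (l, k) \<in> nonroot_nodes \<I> \<Longrightarrow>
        is_orth (matricize n D (node \<I> l k) \<T> * X l k) (Q l k)"
    and Qp: "\<And>l k. (l, k) \<in> nonroot_nodes \<I> \<Longrightarrow> is_orth_compl (Q l k) (Qp l k)"
    and VX_rank: "\<And>l k. (l, k) \<in> nonroot_nodes \<I> \<Longrightarrow> full_row_rank ((Vh l k)\<^sup>T * X l k)"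
    and YQ_rank: "\<And>l k. (l, k) \<in> nonroot_nodes \<I> \<Longrightarrow> full_col_rank ((Y l k)\<^sup>T * Q l k)"
    and \<rho>: "\<rho> = (\<lambda>l k. sqrt (1 + (spectral_norm
        ((Vhp l k)\<^sup>T * X l k * pinv ((Vh l k)\<^sup>T * X l k)))\<^sup>2))"
    and \<tau>: "\<tau> = (\<lambda>l k. sqrt (1 + (spectral_norm
        (pinv ((Y l k)\<^sup>T * Q l k) * ((Y l k)\<^sup>T * Qp l k)))\<^sup>2))"
    and \<eta>: "\<eta> = (\<lambda>l k. 1 + spectral_norm
        (pinv ((Y l k)\<^sup>T * Q l k) * ((Y l k)\<^sup>T * Qp l k)))"
    and best: "is_best_ttn_approx n D \<I> rh \<T> \<T>h"
  shows "frob_norm n D (\<T> - ttnn_approx n D \<I> X Y \<T>) \<le>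
    frob_norm n D (\<T> - \<T>h) *
      (\<Sum>l = 1..height \<I>. \<Sum>k = 1..width \<I> l.
         \<rho> l k * \<tau> l k *
         (\<Prod>m = l + 1..height \<I>. \<Prod>j = 1..width \<I> m. \<eta> m j) *
         (\<Prod>j = k + 1..width \<I> l. \<eta> l j))"
proof -
  define \<delta> where "\<delta> = frob_norm n D (\<T> - \<T>h)"
  define P where "P l k = sketch_proj (matricize n D (node \<I> l k) \<T>) (X l k) (Y l k)" for l k
  define E where "E l = frob_norm n D (\<T> - ttnn_step n D \<I> X Y \<T> l)" for l
  have D_fin: "finite D" by (simp add: D)
  have nodesI: "(l, k) \<in> nodes \<I>" if "(l, k) \<in> nonroot_nodes \<I>" for l k
    using that by (simp add: nonroot_nodes_def)
  have sub: "node \<I> l k \<subseteq> D" if "(l, k) \<in> nonroot_nodes \<I>" for l k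
    by (rule index_tree_node_subset[OF tree nodesI[OF that]])
  have P_carrier: "P l k \<in> carrier_mat (size_of n (node \<I> l k)) (size_of n (node \<I> l k))"
    if lk: "(l, k) \<in> nonroot_nodes \<I>" for l k
    using sketch_proj_carrier[of "Y l k" "matricize n D (node \<I> l k) \<T>" "X l k"] Y[OF lk]
    by (simp add: P_def)
  \<comment> \<open>The own error carries the same \<delta> at every node, so that \<delta> factors
    out of the final sum.\<close>
  have step: "frob_norm n D (\<T> - mode_apply n D (node \<I> l k) (P l k) S)
      \<le> \<eta> l k * frob_norm n D (\<T> - S) + \<rho> l k * \<tau> l k * \<delta>"
    if lk: "(l, k) \<in> nonroot_nodes \<I>" for l k S
  proof (rule mode_apply_residual_le[OF D_fin sub[OF lk] P_carrier[OF lk]])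
    let ?A = "matricize n D (node \<I> l k) \<T>"
    have dims: "dim_row (X l k) = dim_col ?A" "dim_row (Y l k) = dim_row ?A" "dim_row (Vh l k) = dim_col ?A"
      using X[OF lk] Y[OF lk] Vh[OF lk] by (auto simp: first_right_singular_vectors_def)
    note Qs = Q[OF lk] Qp[OF lk]
    show "mat_norm (P l k * matricize n D (node \<I> l k) S) \<le> \<eta> l k * mat_norm (matricize n D (node \<I> l k) S)"
      for S
      using sketch_proj_mult_norm_le[OF dims(1,2) Qs YQ_rank[OF lk]] by (simp add: P_def \<eta>)
    have "0 < l" using lk by (simp add: nonroot_nodes_def)
    then have root_one: "root_one rh l k = rh l k" by (simp add: root_one_def)
    have "has_ttn_rank n D \<I> rh \<T>h" using best unfolding is_best_ttn_approx_def by (rule conjunct1)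
    from has_ttn_rank_matricize[OF D_fin tree this nodesI[OF lk]]
    obtain C F where C: "C \<in> carrier_mat (dim_row ?A) (rh l k)"
      and F: "F \<in> carrier_mat (rh l k) (dim_col ?A)" and CF: "matricize n D (node \<I> l k) \<T>h = C * F"
      unfolding dim_matricize root_one by blast
    have "mat_norm (?A * Vhp l k) \<le> mat_norm (?A - C * F)"
      by (rule Eckart_Young[OF Vh[OF lk] Vhp[OF lk] C F])
    also have "\<dots> = \<delta>"
      unfolding CF[symmetric] matricize_minus[symmetric] \<delta>_def
      by (rule mat_norm_matricize[OF D_fin sub[OF lk]])
    finally have tail: "mat_norm (?A * Vhp l k) \<le> \<delta>" .
    have "mat_norm (?A - P l k * ?A) \<le> \<tau> l k * mat_norm ((Qp l k)\<^sup>T * ?A)"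
      using sketch_proj_residual_le[OF dims(1,2) Qs YQ_rank[OF lk]] by (simp add: P_def \<tau>)
    also have "\<dots> \<le> \<tau> l k * (\<rho> l k * mat_norm (?A * Vhp l k))"
      using range_finder_le[OF dims(1,3) Qs Vhp[OF lk] VX_rank[OF lk]]
      by (intro mult_left_mono) (simp_all add: \<rho> \<tau>)
    also have "\<dots> \<le> \<tau> l k * (\<rho> l k * \<delta>)"
      using tail by (intro mult_left_mono) (simp_all add: \<rho> \<tau>)
    finally show "mat_norm (?A - P l k * ?A) \<le> \<rho> l k * \<tau> l k * \<delta>"
      by (simp add: mult_ac)
  qed
  have \<eta>_nonneg: "0 \<le> \<eta> l k" for l k
    by (simp add: \<eta> add_nonneg_nonneg spectral_norm_nonneg)
  have level: "E (Suc l) \<le> (\<Prod>j = 1..width \<I> (Suc l). \<eta> (Suc l) j) * E l +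
      (\<Sum>k = 1..width \<I> (Suc l). \<rho> (Suc l) k * \<tau> (Suc l) k * \<delta> *
        (\<Prod>j = k + 1..width \<I> (Suc l). \<eta> (Suc l) j))" if l: "Suc l \<le> height \<I>" for l
  proof -
    have nr: "(Suc l, k) \<in> nonroot_nodes \<I>" if "k \<in> {1..width \<I> (Suc l)}" for k
      using that l by (simp add: nonroot_nodes_def nodes_def)
    show ?thesis
      unfolding E_def ttnn_step.simps P_def[symmetric]
    proof (rule level_error_le[OF D_fin])
      fix k assume "k \<in> {1..width \<I> (Suc l)}"
      note k = nr[OF this]
      show "node \<I> (Suc l) k \<subseteq> D" by (rule sub[OF k])
      show "P (Suc l) k \<in> carrier_mat (size_of n (node \<I> (Suc l) k)) (size_of n (node \<I> (Suc l) k))"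
        by (rule P_carrier[OF k])
      show "0 \<le> \<eta> (Suc l) k" by (rule \<eta>_nonneg)
      show "frob_norm n D (\<T> - mode_apply n D (node \<I> (Suc l) k) (P (Suc l) k) S)
          \<le> \<eta> (Suc l) k * frob_norm n D (\<T> - S) + \<rho> (Suc l) k * \<tau> (Suc l) k * \<delta>" for S
        by (rule step[OF k])
    next
      fix j k assume "j \<in> {1..width \<I> (Suc l)}" "k \<in> {1..width \<I> (Suc l)}" "j \<noteq> k"
      then show "node \<I> (Suc l) j \<inter> node \<I> (Suc l) k = {}"
        by (intro index_tree_level_disjoint[OF tree] nodesI nr)
    qed
  qed
  \<comment> \<open>The claim with \<open>L\<close> in place of the height: passing to the next
    level multiplies all earlier terms by its \<eta> and appends one new group of summands.\<close>
  have "E L \<le> \<delta> * (\<Sum>l = 1..L. \<Sum>k = 1..width \<I> l. \<rho> l k * \<tau> l k *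
      (\<Prod>m = l + 1..L. \<Prod>j = 1..width \<I> m. \<eta> m j) * (\<Prod>j = k + 1..width \<I> l. \<eta> l j))"
    if "L \<le> height \<I>" for L
    using that
  proof (induction L)
    case 0
    then show ?case by (simp add: E_def frob_norm_def)
  next
    case (Suc L)
    let ?c = "\<lambda>l k. \<rho> l k * \<tau> l k" and ?s = "\<lambda>l k. \<Prod>j = k + 1..width \<I> l. \<eta> l j"
    let ?p = "\<lambda>l L. \<Prod>m = l + 1..L. \<Prod>j = 1..width \<I> m. \<eta> m j"
    let ?h = "\<Prod>j = 1..width \<I> (Suc L). \<eta> (Suc L) j"
    have "E (Suc L) \<le> ?h * E L + (\<Sum>k = 1..width \<I> (Suc L). ?c (Suc L) k * \<delta> * ?s (Suc L) k)"
      using Suc.prems by (rule level)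
    also have "\<dots> \<le> ?h * (\<delta> * (\<Sum>l = 1..L. \<Sum>k = 1..width \<I> l. ?c l k * ?p l L * ?s l k)) +
        (\<Sum>k = 1..width \<I> (Suc L). ?c (Suc L) k * \<delta> * ?s (Suc L) k)"
      using Suc by (intro add_right_mono mult_left_mono prod_nonneg) (simp_all add: \<eta>_nonneg)
    \<comment> \<open>The factor \<open>?p (Suc L) (Suc L)\<close> is an empty product, inserted to
      give the new summands the common shape.\<close>
    also have "(\<Sum>k = 1..width \<I> (Suc L). ?c (Suc L) k * \<delta> * ?s (Suc L) k) =
        \<delta> * (\<Sum>k = 1..width \<I> (Suc L). ?c (Suc L) k * ?p (Suc L) (Suc L) * ?s (Suc L) k)"
      by (simp add: sum_distrib_left mult_ac)
    also have "?h * (\<delta> * (\<Sum>l = 1..L. \<Sum>k = 1..width \<I> l. ?c l k * ?p l L * ?s l k)) =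
        \<delta> * (\<Sum>l = 1..L. \<Sum>k = 1..width \<I> l. ?c l k * ?p l (Suc L) * ?s l k)"
    proof -
      have p: "?p l (Suc L) = ?p l L * ?h" if "l \<in> {1..L}" for l
        using that by (simp add: mult.commute)
      have "?h * (\<Sum>l = 1..L. \<Sum>k = 1..width \<I> l. ?c l k * ?p l L * ?s l k) =
          (\<Sum>l = 1..L. \<Sum>k = 1..width \<I> l. ?c l k * (?p l L * ?h) * ?s l k)"
        unfolding sum_distrib_left by (intro sum.cong refl) (simp only: mult_ac)
      also have "\<dots> = (\<Sum>l = 1..L. \<Sum>k = 1..width \<I> l. ?c l k * ?p l (Suc L) * ?s l k)"
        by (intro sum.cong refl) (simp only: p)
      finally show ?thesis by (simp only: mult.left_commute)
    qed
    finally show ?case by (simp add: distrib_left)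
  qed
  from this[of "height \<I>"] show ?thesis
    by (simp add: E_def ttnn_approx_def \<delta>_def)
qed

end
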